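(* Let $d\geq 1$ and $k\ge 2d+1$ be integers. Then there exist $\epsilon>0$ and an infinite family $\{G_i\}_{i\in\mathbb N}$ of $k$-regular graphs of increasing size such that $a_d(G_i)\ge \epsilon$ for all $i\in\mathbb N$; that is, there exists an infinite family of $k$-regular $d$-rigidity expander graphs.
   Context: Let $G=(V,E)$ be a finite simple graph and $p:V\to\mathbb R^d$ any map. For $u,v\in V$ let $d_{uv}=\frac{p(u)-p(v)}{\|p(u)-p(v)\|}$ if $p(u)\ne p(v)$ and $d_{uv}=0$ otherwise, and let $\mathbf v_{u,v}=(1_u-1_v)\otimes d_{uv}\in\mathbb R^{d|V|}$, where $\{1_u\}$ is the standard basis of $\mathbb R^{|V|}$ and $\otimes$ is the Kronecker product. The rigidity matrix $R(G,p)\in\mathbb R^{d|V|\times|E|}$ has columns $\mathbf v_{u,v}$ for $\{u,v\}\in E$, and the stiffness matrix is $L(G,p)=R(G,p)R(G,p)^T$. Writing $\lambda_i(A)$ for the $i$-th smallest eigenvalue of a symmetric matrix $A$, the $d$-dimensional algebraic connectivity is $a_d(G)=\sup\{\lambda_{\binom{d+1}{2}+1}(L(G,p)) : p:V\to\mathbb R^d\}$. A family of graphs of increasing size is a family of $d$-rigidity expanders if there is $\epsilon>0$ with $a_d(G_i)\ge\epsilon$ for all $i$. *)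

theory Defs
  imports
    Complex_Main
    "HOL-Library.FuncSet"
    "HOL-Library.Multiset"
    "HOL-Computational_Algebra.Polynomial"
    "Jordan_Normal_Form.Char_Poly"
begin

definition finite_simple_graph :: "'a set \<Rightarrow> 'a set set \<Rightarrow> bool" where
  "finite_simple_graph V E \<longleftrightarrow> finite V \<and> (\<forall>e\<in>E. e \<subseteq> V \<and> card e = 2)"

definition regular_graph :: "nat \<Rightarrow> 'a set \<Rightarrow> 'a set set \<Rightarrow> bool" where
  "regular_graph k V E \<longleftrightarrow> (\<forall>v\<in>V. card {e \<in> E. v \<in> e} = k)"

definition euclid_norm :: "real vec \<Rightarrow> real" where
  "euclid_norm x = sqrt (x \<bullet> x)"

definition direction :: "nat \<Rightarrow> ('a \<Rightarrow> real vec) \<Rightarrow> 'a \<Rightarrow> 'a \<Rightarrow> real vec" where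
  "direction d p u v =
     (if p u = p v then 0\<^sub>v d
      else (1 / euclid_norm (p u - p v)) \<cdot>\<^sub>v (p u - p v))"

definition kronecker_vec :: "real vec \<Rightarrow> real vec \<Rightarrow> real vec" where
  "kronecker_vec x y =
     vec (dim_vec x * dim_vec y) (\<lambda>i. x $ (i div dim_vec y) * y $ (i mod dim_vec y))"

text \<open>Matrices have index set \<open>{0..<n}\<close>, so the vertices are numbered in increasing order.\<close>

definition vertex_vec :: "'a::linorder set \<Rightarrow> 'a \<Rightarrow> real vec" where
  "vertex_vec V u = unit_vec (card V) (card {w \<in> V. w < u})"

definition edge_vec ::
  "nat \<Rightarrow> 'a::linorder set \<Rightarrow> ('a \<Rightarrow> real vec) \<Rightarrow> 'a \<Rightarrow> 'a \<Rightarrow> real vec" where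
  "edge_vec d V p u v = kronecker_vec (vertex_vec V u - vertex_vec V v) (direction d p u v)"

text \<open>Each edge \<open>{u, v}\<close> is listed once, as the pair with \<open>u < v\<close>; the choice of orientation
  is immaterial, since \<open>edge_vec d V p u v\<close> is symmetric in \<open>u\<close> and \<open>v\<close>.\<close>

definition edge_list :: "'a::linorder set \<Rightarrow> 'a set set \<Rightarrow> ('a \<times> 'a) list" where
  "edge_list V E =
     [(u, v). u \<leftarrow> sorted_list_of_set V, v \<leftarrow> sorted_list_of_set V, u < v \<and> {u, v} \<in> E]"

definition rigidity_matrix ::
  "nat \<Rightarrow> 'a::linorder set \<Rightarrow> 'a set set \<Rightarrow> ('a \<Rightarrow> real vec) \<Rightarrow> real mat" where
  "rigidity_matrix d V E p =
     mat_of_cols (d * card V) (map (\<lambda>(u, v). edge_vec d V p u v) (edge_list V E))"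

definition stiffness_matrix ::
  "nat \<Rightarrow> 'a::linorder set \<Rightarrow> 'a set set \<Rightarrow> ('a \<Rightarrow> real vec) \<Rightarrow> real mat" where
  "stiffness_matrix d V E p = rigidity_matrix d V E p * (rigidity_matrix d V E p)\<^sup>T"

text \<open>The \<open>i\<close>-th smallest eigenvalue, counted with multiplicity and starting from \<open>i = 1\<close>.
  It is meaningful for a symmetric matrix and \<open>1 \<le> i \<le> dim_row A\<close>: then all
  roots of the characteristic polynomial are real.\<close>

definition ith_eigenvalue :: "nat \<Rightarrow> real mat \<Rightarrow> real" where
  "ith_eigenvalue i A = sorted_list_of_multiset (proots (char_poly A)) ! (i - 1)"

text \<open>The supremum is over a nonempty set, bounded above by the trace \<open>2 * card E\<close>
  if \<open>(d + 1 choose 2) + 1 \<le> d * card V\<close>.\<close>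

definition algebraic_connectivity :: "nat \<Rightarrow> 'a::linorder set \<Rightarrow> 'a set set \<Rightarrow> real" where
  "algebraic_connectivity d V E =
     (SUP p \<in> V \<rightarrow> carrier_vec d.
        ith_eigenvalue ((d + 1 choose 2) + 1) (stiffness_matrix d V E p))"

end

theory Submission
  imports
    Defs
    "Jordan_Normal_Form.Schur_Decomposition"
    "Jordan_Normal_Form.Spectral_Radius"
begin

text \<open>
  Split the vertices into \<open>d\<close> classes and put class \<open>i\<close> (almost) at the \<open>i\<close>-th standard basis vector
  \<open>e\<^sub>i\<close>, slightly spread out along the line of \<open>e\<^sub>i\<close>. An edge inside class \<open>i\<close> then controls the
  difference of the \<open>i\<close>-th coordinates of a displacement field \<open>x\<close>, and an edge between classes
  \<open>i\<close> and \<open>j\<close> the difference of the function \<open>x\<^sub>i - x\<^sub>j\<close>. If the graph inside every class and the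
  bipartite graph between any two classes satisfy a Poincare inequality, the stiffness form is
  therefore bounded below on the common kernel of \<open>d + (d choose 2) = (d + 1 choose 2)\<close> linear
  functionals (the means), and Courant-Fischer bounds the next eigenvalue.

  Degree \<open>2 d + 1\<close> suffices because a subdivided expander is still an expander: every vertex has
  degree 3 in exactly one of the \<open>d\<close> graphs it belongs to and degree 2 in the others. The base
  expander is the Margulis action on the torus; its Fourier transform satisfies a ping-pong
  estimate on the nonzero lattice points.
\<close>

section \<open>Spectral gap of the Margulis action\<close>

text \<open>The tight case is k = 2 d + 1. A vertex takes part in d graphs, and keeping each of them
  connected along a fiber by cycles already costs degree 2 d. A single edge per vertex remains to
  carry the expansion, so this edge has to serve the d graphs in turn: hence fibers of length
  \<open>q * d\<close>, with one block of positions for each class. The length depends on d and k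
  alone while the base \<open>W\<close> grows, so the loss in the Poincare constant is uniform. The
  remaining edges must form a perfect matching without loops, and for that the Margulis permutations
  are doubled into involutions without fixed points. The spreading is forced by the convention that
  coinciding points have direction 0: a class placed at one point would lose its inner edges. Since
  the algebraic connectivity is a supremum over placements, the spread may shrink as the graph
  grows, and its effect on the edges between classes is absorbed.\<close>

lemma sum_periodic_shift:
  fixes g :: "int \<Rightarrow> 'a::comm_monoid_add" and n :: int
  assumes n: "n > 0" and per: "\<And>x. g (x mod n) = g x"
  shows "(\<Sum>x\<in>{c..<c+n}. g x) = (\<Sum>x\<in>{0..<n}. g x)"
proof (rule sum.reindex_bij_witness[where j = "\<lambda>x. x mod n" and i = "\<lambda>y. c + (y - c) mod n"])
  fix a assume "a \<in> {c..<c+n}"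
  then have "(a - c) mod n = a - c" by simp
  then show "c + (a mod n - c) mod n = a" by (simp add: mod_diff_left_eq)
qed (use n per in \<open>auto simp: mod_add_right_eq\<close>)

lemma sum_periodic_add:
  fixes g :: "int \<Rightarrow> 'a::comm_monoid_add" and n :: int
  assumes n: "n > 0" and per: "\<And>x. g (x mod n) = g x"
  shows "(\<Sum>x\<in>{0..<n}. g (x + c)) = (\<Sum>x\<in>{0..<n}. g x)"
proof -
  have "(\<Sum>x\<in>{0..<n}. g (x + c)) = (\<Sum>x\<in>{c..<c+n}. g x)"
    by (rule sum.reindex_bij_witness[where j = "\<lambda>x. x + c" and i = "\<lambda>y. y - c"]) auto
  also have "\<dots> = (\<Sum>x\<in>{0..<n}. g x)" using n per by (rule sum_periodic_shift)
  finally show ?thesis .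
qed

section \<open>Characters and the Fourier transform of the discrete torus\<close>

definition root_char :: "int \<Rightarrow> int \<Rightarrow> complex" where
  "root_char n k = cis (2 * pi * of_int k / of_int n)"

lemma root_char_add: "root_char n (a + b) = root_char n a * root_char n b"
  by (simp add: root_char_def cis_mult ring_distribs add_divide_distrib)

lemma root_char_diff: "root_char n (a - b) = root_char n a * root_char n (- b)"
  using root_char_add[of n a "- b"] by simp

lemma root_char_0 [simp]: "root_char n 0 = 1"
  by (simp add: root_char_def)

lemma cnj_root_char: "cnj (root_char n k) = root_char n (- k)"
  by (simp add: root_char_def cis_cnj)

lemma root_char_eq_1_iff:
  assumes "n > 0"
  shows "root_char n k = 1 \<longleftrightarrow> n dvd k"
proof -
  have "root_char n k = 1 \<longleftrightarrow> (\<exists>m::int. 2 * pi * of_int k / of_int n = of_int m * (2 * pi))"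
    unfolding root_char_def
    by (metis cis.sel(1) cis_multiple_2pi Ints_of_int cos_one_2pi_int mult.commute mult.left_commute
        one_complex.sel(1))
  also have "\<dots> \<longleftrightarrow> (\<exists>m::int. real_of_int k = of_int (n * m))"
    using assms by (simp add: field_simps)
  also have "\<dots> \<longleftrightarrow> n dvd k"
    unfolding of_int_eq_iff by (auto simp: dvd_def)
  finally show ?thesis .
qed

lemma root_char_cong:
  assumes "n > 0" "a mod n = b mod n"
  shows "root_char n a = root_char n b"
proof -
  have "n dvd a - b" using assms(2) by (simp add: mod_eq_dvd_iff)
  then have "root_char n (a - b) = 1" using root_char_eq_1_iff assms(1) by blast
  then show ?thesis using root_char_add[of n "a - b" b] by simp
qed

text \<open>Shifting the summation index multiplies the sum by \<open>root_char n k\<close>, so it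
  vanishes unless that factor is 1.\<close>

lemma sum_root_char:
  assumes n: "n > 0"
  shows "(\<Sum>a\<in>{0..<n}. root_char n (a * k)) = (if n dvd k then of_int n else 0)"
proof (cases "n dvd k")
  case True
  then have "root_char n (a * k) = 1" for a using root_char_eq_1_iff[OF n] by simp
  then show ?thesis using True n by simp
next
  case False
  let ?S = "\<Sum>a\<in>{0..<n}. root_char n (a * k)"
  have "?S = (\<Sum>a\<in>{0..<n}. root_char n ((a + 1) * k))"
    by (rule sum_periodic_add[symmetric, OF n]) (rule root_char_cong[OF n], simp add: mod_mult_left_eq)
  also have "\<dots> = root_char n k * ?S"
    by (simp add: ring_distribs root_char_add sum_distrib_left mult.commute)
  finally have "(root_char n k - 1) * ?S = 0" by (simp add: algebra_simps)
  then show ?thesis using False root_char_eq_1_iff[OF n] by simp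
qed

lemma parseval_1d:
  fixes f :: "int \<Rightarrow> complex"
  assumes n: "n > 0"
  shows "(\<Sum>a\<in>{0..<n}. (norm (\<Sum>x\<in>{0..<n}. f x * root_char n (- (a * x))))\<^sup>2)
       = of_int n * (\<Sum>x\<in>{0..<n}. (norm (f x))\<^sup>2)"
proof -
  let ?D = "{0..<n}"
  have "complex_of_real (\<Sum>a\<in>?D. (norm (\<Sum>x\<in>?D. f x * root_char n (- (a * x))))\<^sup>2)
     = (\<Sum>a\<in>?D. \<Sum>x\<in>?D. \<Sum>y\<in>?D. f x * cnj (f y) * root_char n (a * (y - x)))"
    unfolding of_real_sum
  proof (rule sum.cong[OF refl])
    fix a
    have "complex_of_real ((norm (\<Sum>x\<in>?D. f x * root_char n (- (a * x))))\<^sup>2)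
      = (\<Sum>x\<in>?D. f x * root_char n (- (a * x))) * (\<Sum>y\<in>?D. cnj (f y) * root_char n (a * y))"
      by (simp add: complex_norm_square cnj_root_char flip: of_real_power)
    also have "\<dots> = (\<Sum>x\<in>?D. \<Sum>y\<in>?D. f x * cnj (f y) * root_char n (a * (y - x)))"
      unfolding sum_product
      by (intro sum.cong refl) (simp add: ring_distribs root_char_diff mult_ac)
    finally show "complex_of_real ((norm (\<Sum>x\<in>?D. f x * root_char n (- (a * x))))\<^sup>2)
      = (\<Sum>x\<in>?D. \<Sum>y\<in>?D. f x * cnj (f y) * root_char n (a * (y - x)))" .
  qed
  also have "\<dots> = (\<Sum>x\<in>?D. \<Sum>y\<in>?D. \<Sum>a\<in>?D. f x * cnj (f y) * root_char n (a * (y - x)))"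
    by (subst sum.swap) (rule sum.cong[OF refl], rule sum.swap)
  also have "\<dots> = (\<Sum>x\<in>?D. \<Sum>y\<in>?D. if y = x then of_int n * (f x * cnj (f x)) else 0)"
  proof (intro sum.cong refl)
    fix x y assume xy: "x \<in> ?D" "y \<in> ?D"
    have "n dvd (y - x) \<longleftrightarrow> y = x"
      using xy by (auto simp: mod_eq_dvd_iff[symmetric])
    then show "(\<Sum>a\<in>?D. f x * cnj (f y) * root_char n (a * (y - x)))
      = (if y = x then of_int n * (f x * cnj (f x)) else 0)"
      by (simp add: sum_distrib_left[symmetric] sum_root_char[OF n])
  qed
  also have "\<dots> = complex_of_real (of_int n * (\<Sum>x\<in>?D. (norm (f x))\<^sup>2))"
    by (simp add: sum_distrib_left complex_norm_square flip: of_real_power)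
  finally show ?thesis unfolding of_real_eq_iff .
qed

text \<open>The transform is unnormalised, which is where the factor
  \<open>(of_int n)\<^sup>2\<close> of Parseval comes from. The sum over x is nested as a
  coefficient in the sum over y so that \<open>parseval_1d\<close> applies once in each
  variable.\<close>

definition dft2 :: "int \<Rightarrow> (int \<Rightarrow> int \<Rightarrow> complex) \<Rightarrow> int \<Rightarrow> int \<Rightarrow> complex" where
  "dft2 n f a b = (\<Sum>y\<in>{0..<n}. (\<Sum>x\<in>{0..<n}. f x y * root_char n (- (a * x))) * root_char n (- (b * y)))"

lemma parseval_2d:
  assumes n: "n > 0"
  shows "(\<Sum>a\<in>{0..<n}. \<Sum>b\<in>{0..<n}. (norm (dft2 n f a b))\<^sup>2)
       = (of_int n)\<^sup>2 * (\<Sum>x\<in>{0..<n}. \<Sum>y\<in>{0..<n}. (norm (f x y))\<^sup>2)"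
proof -
  let ?D = "{0..<n}"
  have "(\<Sum>a\<in>?D. \<Sum>b\<in>?D. (norm (dft2 n f a b))\<^sup>2)
      = of_int n * (\<Sum>a\<in>?D. \<Sum>y\<in>?D. (norm (\<Sum>x\<in>?D. f x y * root_char n (- (a * x))))\<^sup>2)"
    unfolding dft2_def parseval_1d[OF n] sum_distrib_left[symmetric] ..
  also have "\<dots> = of_int n * (\<Sum>y\<in>?D. \<Sum>a\<in>?D. (norm (\<Sum>x\<in>?D. f x y * root_char n (- (a * x))))\<^sup>2)"
    by (subst sum.swap) (rule refl)
  also have "\<dots> = (of_int n)\<^sup>2 * (\<Sum>y\<in>?D. \<Sum>x\<in>?D. (norm (f x y))\<^sup>2)"
    unfolding parseval_1d[OF n] sum_distrib_left[symmetric] power2_eq_square[of "real_of_int n"] mult.assoc ..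
  finally show ?thesis by (subst sum.swap)
qed

lemma dft2_diff: "dft2 n (\<lambda>x y. f x y - g x y) a b = dft2 n f a b - dft2 n g a b"
  by (simp add: dft2_def left_diff_distrib sum_subtractf)

lemma dft2_mod:
  assumes n: "n > 0"
  shows "dft2 n f (a mod n) b = dft2 n f a b" "dft2 n f a (b mod n) = dft2 n f a b"
  unfolding dft2_def
  by (intro sum.cong refl arg_cong2[where f = "(*)"] root_char_cong[OF n];
      metis mod_minus_cong mod_mult_left_eq)+

lemma dft2_swap: "dft2 n f a b = dft2 n (\<lambda>x y. f y x) b a"
  unfolding dft2_def sum_distrib_right by (subst sum.swap) (simp add: mult_ac)

lemma dft2_translate:
  assumes n: "n > 0" and per: "\<And>x y. f (x mod n) y = f x y"
  shows "dft2 n (\<lambda>x y. f (x + 1) y) a b = root_char n a * dft2 n f a b"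
proof -
  have "(\<Sum>x\<in>{0..<n}. f (x + 1) y * root_char n (- (a * x)))
     = root_char n a * (\<Sum>x\<in>{0..<n}. f x y * root_char n (- (a * x)))" for y
  proof -
    have "(\<Sum>x\<in>{0..<n}. f (x + 1) y * root_char n (- (a * x)))
        = (\<Sum>x\<in>{0..<n}. f (x + 1) y * root_char n (- (a * (x + 1 - 1))))" by simp
    also have "\<dots> = (\<Sum>x\<in>{0..<n}. f x y * root_char n (- (a * (x - 1))))"
      by (rule sum_periodic_add[OF n, where g = "\<lambda>x. f x y * root_char n (- (a * (x - 1)))"])
         (simp add: per, rule disjI2, rule root_char_cong[OF n],
          metis mod_minus_cong mod_mult_right_eq mod_diff_left_eq)
    also have "\<dots> = root_char n a * (\<Sum>x\<in>{0..<n}. f x y * root_char n (- (a * x)))"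
      by (simp add: ring_distribs root_char_diff sum_distrib_left mult_ac)
    finally show ?thesis .
  qed
  then show ?thesis by (simp add: dft2_def sum_distrib_left mult_ac)
qed

text \<open>A linear substitution acts on frequencies by the inverse transpose. Here, replacing x +
  y by x in the inner sum leaves the factor \<open>root_char n (a * y)\<close>, which turns the
  frequency b into b - a.\<close>

lemma dft2_shear:
  assumes n: "n > 0" and per: "\<And>x y. f (x mod n) y = f x y"
  shows "dft2 n (\<lambda>x y. f (x + y) y) a b = dft2 n f a (b - a)"
proof -
  have "(\<Sum>x\<in>{0..<n}. f (x + y) y * root_char n (- (a * x)))
     = root_char n (a * y) * (\<Sum>x\<in>{0..<n}. f x y * root_char n (- (a * x)))" for y
  proof -
    have "(\<Sum>x\<in>{0..<n}. f (x + y) y * root_char n (- (a * x)))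
        = (\<Sum>x\<in>{0..<n}. f (x + y) y * root_char n (- (a * (x + y - y))))" by simp
    also have "\<dots> = (\<Sum>x\<in>{0..<n}. f x y * root_char n (- (a * (x - y))))"
      by (rule sum_periodic_add[OF n, where g = "\<lambda>x. f x y * root_char n (- (a * (x - y)))"])
         (simp add: per, rule disjI2, rule root_char_cong[OF n],
          metis mod_minus_cong mod_mult_right_eq mod_diff_left_eq)
    also have "\<dots> = root_char n (a * y) * (\<Sum>x\<in>{0..<n}. f x y * root_char n (- (a * x)))"
      by (simp add: ring_distribs root_char_diff sum_distrib_left mult_ac)
    finally show ?thesis .
  qed
  then show ?thesis
    by (simp add: dft2_def ring_distribs root_char_diff mult_ac)
qed

section \<open>Ping-pong on the frequency lattice\<close>

text \<open>Adding the two estimates counts \<open>sum m P\<close> twice on the left, whereas the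
  disjoint images on the right contribute at most 3/2 of the mass of \<open>P \<union> R\<close>.
  The surplus of 1/2 bounds \<open>sum m P\<close>; what matters is that 3/2 is below 2.\<close>

lemma ping_pong_mass:
  fixes m ku kv :: "'z \<Rightarrow> real"
  assumes fin: "finite P" "finite R" and m: "\<And>z. m z \<ge> 0"
    and inj: "inj_on u P" "inj_on v P"
    and disj: "u ` P \<inter> v ` P = {}" and sub: "u ` P \<union> v ` P \<subseteq> P \<union> R"
    and ku: "\<And>z. z \<in> P \<Longrightarrow> m z \<le> 3/2 * m (u z) + 3 * ku z"
    and kv: "\<And>z. z \<in> P \<Longrightarrow> m z \<le> 3/2 * m (v z) + 3 * kv z"
  shows "sum m P \<le> 6 * sum ku P + 6 * sum kv P + 3 * sum m R"
proof -
  have "sum m P \<le> (\<Sum>z\<in>P. 3/2 * m (u z) + 3 * ku z)" using ku by (rule sum_mono)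
  then have u: "sum m P \<le> 3/2 * sum m (u ` P) + 3 * sum ku P"
    by (simp add: sum.distrib sum_distrib_left sum.reindex[OF inj(1)])
  have "sum m P \<le> (\<Sum>z\<in>P. 3/2 * m (v z) + 3 * kv z)" using kv by (rule sum_mono)
  then have v: "sum m P \<le> 3/2 * sum m (v ` P) + 3 * sum kv P"
    by (simp add: sum.distrib sum_distrib_left sum.reindex[OF inj(2)])
  have "sum m (u ` P) + sum m (v ` P) = sum m (u ` P \<union> v ` P)"
    using fin disj by (intro sum.union_disjoint[symmetric]) auto
  also have "\<dots> \<le> sum m (P \<union> R)" using sub fin m by (intro sum_mono2) auto
  also have "\<dots> \<le> sum m P + sum m R"
    using fin m by (simp add: sum_Un sum_nonneg)
  finally show ?thesis using u v by linarith
qed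

text \<open>The inequality (s + t)^2 \<le> (1 + \<delta>) s^2 + (1 + 1/\<delta>) t^2 at \<delta> =
  1/2. The usual factor 2 in front of the first term would be too large for
  \<open>ping_pong_mass\<close>.\<close>

lemma norm_square_perturb:
  fixes p q :: complex
  shows "(norm p)\<^sup>2 \<le> 3/2 * (norm q)\<^sup>2 + 3 * (norm (q - p))\<^sup>2"
proof -
  have "norm p \<le> norm q + norm (q - p)" by (metis norm_triangle_sub norm_minus_commute)
  then have "(norm p)\<^sup>2 \<le> (norm q + norm (q - p))\<^sup>2" by (simp add: power_mono)
  moreover have "0 \<le> (norm q - 2 * norm (q - p))\<^sup>2" by simp
  ultimately show ?thesis by (simp add: power2_eq_square algebra_simps)
qed

text \<open>The angle t = 2 pi a / (8 r) lies between pi/4 and pi in absolute value, and |e^(it) -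
  1|^2 = 2 - 2 cos t \<ge> 2 - sqrt 2 > 1/2. This is why the torus has side \<open>8 * r\<close>
  when the ping-pong square has radius r.\<close>

lemma root_char_far_from_1:
  fixes r a :: int
  assumes r: "r > 0" and a: "r \<le> \<bar>a\<bar>" "\<bar>a\<bar> \<le> 4 * r"
  shows "1 \<le> 2 * (norm (root_char (8 * r) a - 1))\<^sup>2"
proof -
  define t where "t = 2 * pi * of_int a / of_int (8 * r)"
  have t: "\<bar>t\<bar> = pi * (real_of_int \<bar>a\<bar> / (4 * real_of_int r))"
    using r by (simp add: t_def abs_mult)
  have "real_of_int r \<le> real_of_int \<bar>a\<bar>" "real_of_int \<bar>a\<bar> \<le> real_of_int (4 * r)"
    using a by linarith+
  then have "1/4 \<le> real_of_int \<bar>a\<bar> / (4 * real_of_int r)" "real_of_int \<bar>a\<bar> / (4 * real_of_int r) \<le> 1"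
    using r by (simp_all add: field_simps)
  from mult_left_mono[OF this(1), of pi] mult_left_mono[OF this(2), of pi]
  have b: "pi / 4 \<le> \<bar>t\<bar>" "\<bar>t\<bar> \<le> pi"
    unfolding t by simp_all
  have "cos \<bar>t\<bar> \<le> cos (pi / 4)" using b by (intro cos_monotone_0_pi_le) auto
  then have "cos t \<le> sqrt 2 / 2" by (simp add: cos_45)
  also have "\<dots> \<le> 3/4" using real_le_lsqrt[of "3/2" 2] by (simp add: power2_eq_square)
  finally have c: "cos t \<le> 3/4" .
  have "(norm (root_char (8 * r) a - 1))\<^sup>2 = (cos t - 1)\<^sup>2 + (sin t)\<^sup>2"
    unfolding root_char_def t_def[symmetric] by (simp add: cmod_power2)
  also have "\<dots> = 2 - 2 * cos t"
    using sin_cos_squared_add[of t] by (simp add: power2_eq_square algebra_simps)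
  finally show ?thesis using c by simp
qed

text \<open>\<open>F\<close> is the Fourier transform of a mean-zero function. Near the origin the dual shears act as on the
  integer lattice, where \<open>(a, b) \<mapsto> (a, a + b)\<close> and \<open>(a, b) \<mapsto> (a + b, b)\<close> map the first and third
  quadrants into disjoint subsets of themselves; their inverses do the same to the other two
  quadrants. Almost invariance thus leaves little mass there, and the translations control the mass
  away from the origin.\<close>

lemma dual_torus_mass:
  fixes F :: "int \<Rightarrow> int \<Rightarrow> complex" and r :: int
  assumes r: "r > 0" and F0: "F 0 0 = 0"
  defines "D \<equiv> {- 4 * r..<4 * r} \<times> {- 4 * r..<4 * r}"
  shows "(\<Sum>(a, b)\<in>D. (norm (F a b))\<^sup>2) \<le> 14 *
     ((\<Sum>(a, b)\<in>D. (norm (root_char (8 * r) a * F a b - F a b))\<^sup>2)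
    + (\<Sum>(a, b)\<in>D. (norm (root_char (8 * r) b * F a b - F a b))\<^sup>2)
    + (\<Sum>(a, b)\<in>D. (norm (F a (b - a) - F a b))\<^sup>2)
    + (\<Sum>(a, b)\<in>D. (norm (F (a - b) b - F a b))\<^sup>2))"
proof -
  define m where "m = (\<lambda>(a, b). (norm (F a b))\<^sup>2)"
  define k1 where "k1 = (\<lambda>(a, b). (norm (root_char (8 * r) a * F a b - F a b))\<^sup>2)"
  define k2 where "k2 = (\<lambda>(a, b). (norm (root_char (8 * r) b * F a b - F a b))\<^sup>2)"
  define k3 where "k3 = (\<lambda>(a, b). (norm (F a (b - a) - F a b))\<^sup>2)"
  define k4 where "k4 = (\<lambda>(a, b). (norm (F (a - b) b - F a b))\<^sup>2)"
  define B where "B = {- r<..<r} \<times> {- r<..<r}"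
  define R where "R = D - B"
  \<comment> \<open>The half-axes are distributed so that \<open>P\<close> and \<open>P'\<close>
    partition \<open>B\<close> without the origin; the coordinate with a strict sign keeps the two
    images under the shears disjoint.\<close>
  define P where "P = {(a, b) \<in> B. a > 0 \<and> b \<ge> 0 \<or> a < 0 \<and> b \<le> 0}"
  define P' where "P' = {(a, b) \<in> B. a \<le> 0 \<and> b > 0 \<or> a \<ge> 0 \<and> b < 0}"
  have finD: "finite D" "finite B" unfolding D_def B_def by auto
  have BD: "B \<subseteq> D" using r unfolding B_def D_def by auto
  have fin: "finite P" "finite P'" "finite R"
    using finD finite_subset[of P B] finite_subset[of P' B] by (auto simp: P_def P'_def R_def)
  have nn: "m z \<ge> 0" "k1 z \<ge> 0" "k2 z \<ge> 0" "k3 z \<ge> 0" "k4 z \<ge> 0" for z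
    by (auto simp: m_def k1_def k2_def k3_def k4_def split: prod.splits)
  have "m z \<le> 2 * k1 z + 2 * k2 z" if zR: "z \<in> R" for z
  proof -
    obtain a b where z: "z = (a, b)" by (cases z)
    have k: "k1 z = (norm (root_char (8 * r) a - 1))\<^sup>2 * m z" "k2 z = (norm (root_char (8 * r) b - 1))\<^sup>2 * m z"
      using norm_mult[of "root_char (8 * r) a - 1" "F a b"] norm_mult[of "root_char (8 * r) b - 1" "F a b"]
      by (simp_all add: k1_def k2_def m_def z left_diff_distrib flip: power_mult_distrib)
    have ab: "\<bar>a\<bar> \<le> 4 * r" "\<bar>b\<bar> \<le> 4 * r" "r \<le> \<bar>a\<bar> \<or> r \<le> \<bar>b\<bar>"
      using zR by (auto simp: z R_def D_def B_def)
    have "m z \<le> 2 * k1 z \<or> m z \<le> 2 * k2 z"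
      using ab(3)
    proof
      assume "r \<le> \<bar>a\<bar>"
      from mult_right_mono[OF root_char_far_from_1[OF r this ab(1)] nn(1)[of z]]
      show ?thesis unfolding k by (simp add: mult.assoc)
    next
      assume "r \<le> \<bar>b\<bar>"
      from mult_right_mono[OF root_char_far_from_1[OF r this ab(2)] nn(1)[of z]]
      show ?thesis unfolding k by (simp add: mult.assoc)
    qed
    then show ?thesis using nn(2,3)[of z] by linarith
  qed
  then have "sum m R \<le> (\<Sum>z\<in>R. 2 * k1 z + 2 * k2 z)" by (rule sum_mono)
  also have "\<dots> \<le> (\<Sum>z\<in>D. 2 * k1 z + 2 * k2 z)"
    using finD nn by (intro sum_mono2) (auto simp: R_def)
  finally have mR: "sum m R \<le> 2 * sum k1 D + 2 * sum k2 D" by (simp add: sum.distrib sum_distrib_left)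
  let ?u = "\<lambda>(a::int, b::int). (a, a + b)" and ?v = "\<lambda>(a::int, b::int). (a + b, b)"
  let ?u' = "\<lambda>(a::int, b::int). (a, b - a)" and ?v' = "\<lambda>(a::int, b::int). (a - b, b)"
  have iu: "inj_on ?u P" "inj_on ?v P" "inj_on ?u' P'" "inj_on ?v' P'" by (auto simp: inj_on_def)
  have PD: "?u ` P \<subseteq> D" "?v ` P \<subseteq> D" "P' \<subseteq> D" using BD by (auto simp: P_def P'_def B_def D_def)
  \<comment> \<open>\<open>k3\<close> and \<open>k4\<close> measure inverse shears. On
    \<open>P\<close> the forward shears are used, so the defect of a step from \<open>z\<close> is
    stored at its image and the sum is reindexed along \<open>?u\<close> and \<open>?v\<close>; on
    \<open>P'\<close> it is read off at \<open>z\<close> itself.\<close>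
  have "sum m P \<le> 6 * sum (k3 \<circ> ?u) P + 6 * sum (k4 \<circ> ?v) P + 3 * sum m R"
  proof (rule ping_pong_mass[OF fin(1,3) nn(1) iu(1,2)])
    show "m z \<le> 3/2 * m (?u z) + 3 * (k3 \<circ> ?u) z" for z
      using norm_square_perturb by (auto simp: m_def k3_def norm_minus_commute split: prod.splits)
    show "m z \<le> 3/2 * m (?v z) + 3 * (k4 \<circ> ?v) z" for z
      using norm_square_perturb by (auto simp: m_def k4_def norm_minus_commute split: prod.splits)
    show "?u ` P \<inter> ?v ` P = {}" by (auto simp: P_def)
    show "?u ` P \<union> ?v ` P \<subseteq> P \<union> R" using PD by (auto simp: P_def R_def)
  qed
  also have "sum (k3 \<circ> ?u) P = sum k3 (?u ` P)" by (rule sum.reindex[OF iu(1), symmetric])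
  also have "\<dots> \<le> sum k3 D" using PD finD nn by (intro sum_mono2) auto
  also have "sum (k4 \<circ> ?v) P = sum k4 (?v ` P)" by (rule sum.reindex[OF iu(2), symmetric])
  also have "\<dots> \<le> sum k4 D" using PD finD nn by (intro sum_mono2) auto
  finally have mP: "sum m P \<le> 6 * sum k3 D + 6 * sum k4 D + 3 * sum m R" by simp
  have "sum m P' \<le> 6 * sum k3 P' + 6 * sum k4 P' + 3 * sum m R"
  proof (rule ping_pong_mass[OF fin(2,3) nn(1) iu(3,4)])
    show "m z \<le> 3/2 * m (?u' z) + 3 * k3 z" for z
      using norm_square_perturb by (auto simp: m_def k3_def split: prod.splits)
    show "m z \<le> 3/2 * m (?v' z) + 3 * k4 z" for z
      using norm_square_perturb by (auto simp: m_def k4_def split: prod.splits)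
    show "?u' ` P' \<inter> ?v' ` P' = {}" by (auto simp: P'_def)
    show "?u' ` P' \<union> ?v' ` P' \<subseteq> P' \<union> R" by (auto simp: P'_def R_def B_def D_def)
  qed
  also have "sum k3 P' \<le> sum k3 D" using PD finD nn by (intro sum_mono2) auto
  also have "sum k4 P' \<le> sum k4 D" using PD finD nn by (intro sum_mono2) auto
  finally have mP': "sum m P' \<le> 6 * sum k3 D + 6 * sum k4 D + 3 * sum m R" by simp
  have "D = insert (0, 0) (P \<union> P' \<union> R)" using r BD by (auto simp: P_def P'_def R_def B_def)
  then have "sum m D \<le> sum m (P \<union> P' \<union> R) + m (0, 0)"
    using fin by (simp add: sum.insert_if nn)
  also have "m (0, 0) = 0" by (simp add: m_def F0)
  also have "sum m (P \<union> P' \<union> R) \<le> sum m P + sum m P' + sum m R"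
    using fin nn by (smt (verit, best) finite_UnI sum_Un sum_nonneg)
  \<comment> \<open>\<open>P\<close> and \<open>P'\<close> each cost 3 times \<open>sum m R\<close>;
    with \<open>sum m R\<close> itself this makes 7, and \<open>mR\<close> doubles it to 14. The
    shear terms need only 12.\<close>
  finally have "sum m D \<le> 14 * (sum k1 D + sum k2 D + sum k3 D + sum k4 D)"
    using mP mP' mR sum_nonneg[of D k3] sum_nonneg[of D k4] nn by simp
  then show ?thesis by (simp add: m_def k1_def k2_def k3_def k4_def)
qed

text \<open>Up to a common factor, Parseval carries both sides to the frequency side: translations
  become multiplications by characters, shears become dual shears, and mean zero becomes the value 0
  at the zero frequency, so \<open>dual_torus_mass\<close> applies.\<close>

lemma torus_poincare:
  fixes f :: "int \<Rightarrow> int \<Rightarrow> real" and r :: int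
  assumes r: "r > 0" and per: "\<And>x y. f (x mod (8 * r)) y = f x y" "\<And>x y. f x (y mod (8 * r)) = f x y"
  defines "D \<equiv> {0..<8 * r}"
  assumes mean: "(\<Sum>x\<in>D. \<Sum>y\<in>D. f x y) = 0"
  shows "(\<Sum>x\<in>D. \<Sum>y\<in>D. (f x y)\<^sup>2) \<le> 14 *
     ((\<Sum>x\<in>D. \<Sum>y\<in>D. (f (x + 1) y - f x y)\<^sup>2)
    + (\<Sum>x\<in>D. \<Sum>y\<in>D. (f x (y + 1) - f x y)\<^sup>2)
    + (\<Sum>x\<in>D. \<Sum>y\<in>D. (f (x + y) y - f x y)\<^sup>2)
    + (\<Sum>x\<in>D. \<Sum>y\<in>D. (f x (x + y) - f x y)\<^sup>2))"
proof -
  define n where "n = 8 * r"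
  have n: "n > 0" using r n_def by simp
  define g where "g = (\<lambda>x y. complex_of_real (f x y))"
  have pg: "g (x mod n) y = g x y" "g x (y mod n) = g x y" for x y
    using per by (auto simp: g_def n_def)
  let ?F = "dft2 n g"
  let ?C = "{- 4 * r..<4 * r}"
  \<comment> \<open>Parseval sums over \<open>{0..<n}\<close>, the ping-pong estimate over a square
    centred at the origin; both are fundamental domains of the periodic transform.\<close>
  have plan: "(\<Sum>(a, b)\<in>?C \<times> ?C. (norm (dft2 n h a b))\<^sup>2) = (of_int n)\<^sup>2 * (\<Sum>x\<in>D. \<Sum>y\<in>D. (norm (h x y))\<^sup>2)"
    for h
  proof -
    have C: "?C = {- 4 * r..<- 4 * r + n}" by (simp add: n_def)
    have "(\<Sum>(a, b)\<in>?C \<times> ?C. (norm (dft2 n h a b))\<^sup>2) = (\<Sum>a\<in>?C. \<Sum>b\<in>?C. (norm (dft2 n h a b))\<^sup>2)"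
      by (simp add: sum.cartesian_product)
    also have "\<dots> = (\<Sum>a\<in>?C. \<Sum>b\<in>{0..<n}. (norm (dft2 n h a b))\<^sup>2)"
      unfolding C by (intro sum.cong refl sum_periodic_shift[OF n]) (simp add: dft2_mod[OF n])
    also have "\<dots> = (\<Sum>a\<in>{0..<n}. \<Sum>b\<in>{0..<n}. (norm (dft2 n h a b))\<^sup>2)"
      unfolding C by (intro sum_periodic_shift[OF n]) (simp add: dft2_mod[OF n])
    also note parseval_2d[OF n]
    finally show ?thesis by (simp only: D_def n_def)
  qed
  have t1: "root_char n a * ?F a b - ?F a b = dft2 n (\<lambda>x y. g (x + 1) y - g x y) a b" for a b
    by (simp add: dft2_diff dft2_translate[where f = g, OF n pg(1)])
  have "dft2 n (\<lambda>x y. g x (y + 1)) a b = root_char n b * ?F a b" for a b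
    using dft2_translate[OF n, of "\<lambda>x y. g y x" b a] pg(2) by (simp add: dft2_swap[of n _ a b])
  then have t2: "root_char n b * ?F a b - ?F a b = dft2 n (\<lambda>x y. g x (y + 1) - g x y) a b" for a b
    by (simp add: dft2_diff)
  have t3: "?F a (b - a) - ?F a b = dft2 n (\<lambda>x y. g (x + y) y - g x y) a b" for a b
    by (simp add: dft2_diff dft2_shear[where f = g, OF n pg(1)])
  have "dft2 n (\<lambda>x y. g x (x + y)) a b = ?F (a - b) b" for a b
    using dft2_shear[OF n, of "\<lambda>x y. g y x" b a] pg(2)
    by (simp add: dft2_swap[of n _ a b] dft2_swap[of n _ "a - b" b] add.commute)
  then have t4: "?F (a - b) b - ?F a b = dft2 n (\<lambda>x y. g x (x + y) - g x y) a b" for a b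
    by (simp add: dft2_diff)
  have "?F 0 0 = of_real (\<Sum>y\<in>D. \<Sum>x\<in>D. f x y)"
    by (simp add: dft2_def g_def D_def n_def)
  also have "(\<Sum>y\<in>D. \<Sum>x\<in>D. f x y) = 0" using mean by (subst sum.swap)
  finally have F0: "?F 0 0 = 0" by simp
  have re: "(norm (g x y))\<^sup>2 = (f x y)\<^sup>2" "(norm (g x y - g x' y'))\<^sup>2 = (f x y - f x' y')\<^sup>2" for x y x' y'
    by (simp_all add: g_def norm_of_real flip: of_real_diff)
  from dual_torus_mass[of r ?F, OF r F0, folded n_def, unfolded t1 t2 t3 t4 plan re]
  have "(of_int n)\<^sup>2 * (\<Sum>x\<in>D. \<Sum>y\<in>D. (f x y)\<^sup>2) \<le> (real_of_int n)\<^sup>2 * (14 *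
     ((\<Sum>x\<in>D. \<Sum>y\<in>D. (f (x + 1) y - f x y)\<^sup>2)
    + (\<Sum>x\<in>D. \<Sum>y\<in>D. (f x (y + 1) - f x y)\<^sup>2)
    + (\<Sum>x\<in>D. \<Sum>y\<in>D. (f (x + y) y - f x y)\<^sup>2)
    + (\<Sum>x\<in>D. \<Sum>y\<in>D. (f x (x + y) - f x y)\<^sup>2)))"
    by (simp add: algebra_simps)
  then show ?thesis using n by (simp add: mult_le_cancel_left)
qed

section \<open>From permutations to involutions without fixed points\<close>

lemma square_sum2_le: "(x + y)\<^sup>2 \<le> 2 * x\<^sup>2 + 2 * (y::real)\<^sup>2"
  using sum_squares_bound[of x y] by (simp add: power2_sum)

lemma square_diff_via: "(x - z)\<^sup>2 \<le> 2 * (x - y)\<^sup>2 + 2 * (y - (z::real))\<^sup>2"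
  using square_sum2_le[of "x - y" "y - z"] by simp

text \<open>The bipartite double cover: with \<open>h l\<close> inverse to \<open>g l\<close>, the
  permutation becomes a matching between the copies \<open>False\<close> and \<open>True\<close>.
  Swapping the copies rules out fixed points even where \<open>g l\<close> has some.\<close>

definition double_involution ::
    "(nat \<Rightarrow> 'z \<Rightarrow> 'z) \<Rightarrow> (nat \<Rightarrow> 'z \<Rightarrow> 'z) \<Rightarrow> nat \<Rightarrow> 'z \<times> bool \<Rightarrow> 'z \<times> bool" where
  "double_involution g h l w = (if snd w then (h l (fst w), False) else (g l (fst w), True))"

text \<open>The values on the copy \<open>False\<close> inherit the inequality for \<open>g\<close>:
  a step from z to \<open>g l z\<close> runs through \<open>(g l z, True)\<close> and returns by the
  edge of the identity \<open>g 0\<close>. Edges of that kind also carry the bound over to the copy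
  \<open>True\<close>.\<close>

lemma double_involution_poincare:
  fixes g h :: "nat \<Rightarrow> 'z \<Rightarrow> 'z" and C :: real and \<psi> :: "'z \<times> bool \<Rightarrow> real"
  assumes fin: "finite Z" and C: "C \<ge> 0" and q: "q > 0"
    and g: "\<And>l z. z \<in> Z \<Longrightarrow> g l z \<in> Z" and h: "\<And>l z. z \<in> Z \<Longrightarrow> h l z \<in> Z"
    and hg: "\<And>l z. z \<in> Z \<Longrightarrow> h l (g l z) = z" and gh: "\<And>l z. z \<in> Z \<Longrightarrow> g l (h l z) = z"
    and g0: "\<And>z. z \<in> Z \<Longrightarrow> g 0 z = z"
    and poin: "\<And>\<phi>::'z \<Rightarrow> real. \<exists>a. (\<Sum>z\<in>Z. (\<phi> z - a)\<^sup>2) \<le> C * (\<Sum>l<q. \<Sum>z\<in>Z. (\<phi> (g l z) - \<phi> z)\<^sup>2)"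
  shows "\<exists>a. (\<Sum>w\<in>Z \<times> UNIV. (\<psi> w - a)\<^sup>2)
     \<le> (12 * real q * C + 2) * (\<Sum>l<q. \<Sum>w\<in>Z \<times> UNIV. (\<psi> (double_involution g h l w) - \<psi> w)\<^sup>2)"
proof -
  define E where "E = (\<Sum>l<q. \<Sum>w\<in>Z \<times> UNIV. (\<psi> (double_involution g h l w) - \<psi> w)\<^sup>2)"
  have split: "(\<Sum>w\<in>Z \<times> UNIV. \<phi> w) = (\<Sum>z\<in>Z. \<phi> (z, False)) + (\<Sum>z\<in>Z. \<phi> (z, True))" for \<phi> :: "'z \<times> bool \<Rightarrow> real"
    by (subst sum.cartesian_product[symmetric, of "\<lambda>z b. \<phi> (z, b)", simplified])
       (simp add: UNIV_bool sum.distrib)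
  have el: "(\<Sum>z\<in>Z. (\<psi> (g l z, True) - \<psi> (z, False))\<^sup>2) \<le> E" if l: "l < q" for l
  proof -
    have "(\<Sum>z\<in>Z. (\<psi> (g l z, True) - \<psi> (z, False))\<^sup>2)
        \<le> (\<Sum>w\<in>Z \<times> UNIV. (\<psi> (double_involution g h l w) - \<psi> w)\<^sup>2)"
      unfolding split by (simp add: double_involution_def sum_nonneg)
    also have "\<dots> \<le> E" unfolding E_def
      using l by (intro member_le_sum sum_nonneg) auto
    finally show ?thesis .
  qed
  define \<phi> where "\<phi> z = \<psi> (z, False)" for z
  define e0 where "e0 = (\<Sum>z\<in>Z. (\<psi> (z, True) - \<psi> (z, False))\<^sup>2)"
  have e0: "e0 \<le> E" using el[OF q] by (simp add: g0 e0_def cong: sum.cong)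
  have "(\<Sum>z\<in>Z. (\<phi> (g l z) - \<phi> z)\<^sup>2) \<le> 4 * E" if l: "l < q" for l
  proof -
    have bij: "bij_betw (g l) Z Z"
      using g h hg gh by (intro bij_betw_byWitness[where f' = "h l"]) auto
    have "(\<Sum>z\<in>Z. (\<phi> (g l z) - \<phi> z)\<^sup>2)
      \<le> (\<Sum>z\<in>Z. 2 * (\<psi> (g l z, True) - \<psi> (g l z, False))\<^sup>2 + 2 * (\<psi> (g l z, True) - \<psi> (z, False))\<^sup>2)"
      unfolding \<phi>_def
    proof (rule sum_mono)
      fix z
      show "(\<psi> (g l z, False) - \<psi> (z, False))\<^sup>2
        \<le> 2 * (\<psi> (g l z, True) - \<psi> (g l z, False))\<^sup>2 + 2 * (\<psi> (g l z, True) - \<psi> (z, False))\<^sup>2"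
        using square_diff_via[of "\<psi> (g l z, False)" "\<psi> (z, False)" "\<psi> (g l z, True)"]
        by (simp add: power2_commute)
    qed
    also have "\<dots> = 2 * (\<Sum>z\<in>Z. (\<psi> (g l z, True) - \<psi> (g l z, False))\<^sup>2)
        + 2 * (\<Sum>z\<in>Z. (\<psi> (g l z, True) - \<psi> (z, False))\<^sup>2)"
      by (simp add: sum.distrib sum_distrib_left)
    also have "(\<Sum>z\<in>Z. (\<psi> (g l z, True) - \<psi> (g l z, False))\<^sup>2) = e0"
      unfolding e0_def by (rule sum.reindex_bij_betw[OF bij])
    finally show ?thesis using e0 el[OF l] by linarith
  qed
  then have "(\<Sum>l<q. \<Sum>z\<in>Z. (\<phi> (g l z) - \<phi> z)\<^sup>2) \<le> (\<Sum>l<q. 4 * E)" by (intro sum_mono) simp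
  then have en: "(\<Sum>l<q. \<Sum>z\<in>Z. (\<phi> (g l z) - \<phi> z)\<^sup>2) \<le> 4 * real q * E" by simp
  obtain a where "(\<Sum>z\<in>Z. (\<phi> z - a)\<^sup>2) \<le> C * (\<Sum>l<q. \<Sum>z\<in>Z. (\<phi> (g l z) - \<phi> z)\<^sup>2)"
    using poin by blast
  also have "\<dots> \<le> C * (4 * real q * E)" using en C by (rule mult_left_mono)
  finally have a: "(\<Sum>z\<in>Z. (\<phi> z - a)\<^sup>2) \<le> C * (4 * real q * E)" .
  have "(\<Sum>z\<in>Z. (\<psi> (z, True) - a)\<^sup>2) \<le> (\<Sum>z\<in>Z. 2 * (\<psi> (z, True) - \<psi> (z, False))\<^sup>2 + 2 * (\<phi> z - a)\<^sup>2)"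
    unfolding \<phi>_def by (intro sum_mono square_diff_via)
  then have "(\<Sum>z\<in>Z. (\<psi> (z, True) - a)\<^sup>2) \<le> 2 * e0 + 2 * (\<Sum>z\<in>Z. (\<phi> z - a)\<^sup>2)"
    by (simp add: sum.distrib sum_distrib_left e0_def)
  \<comment> \<open>The deviation on the copy \<open>False\<close> enters once directly and twice
    through the copy \<open>True\<close>, hence 3 * 4 = 12; the 2 comes from
    \<open>e0\<close>.\<close>
  then have "(\<Sum>w\<in>Z \<times> UNIV. (\<psi> w - a)\<^sup>2) \<le> 2 * E + 3 * (C * (4 * real q * E))"
    unfolding split using a e0 by (simp add: \<phi>_def)
  also have "\<dots> = (12 * real q * C + 2) * E" by (simp add: algebra_simps)
  finally show ?thesis unfolding E_def by blast
qed

text \<open>The identity occurs among the maps because doubling needs it to join the two copies of a point.\<close>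

definition torus_map :: "int \<Rightarrow> nat \<Rightarrow> int \<times> int \<Rightarrow> int \<times> int" where
  "torus_map n l = (\<lambda>(x, y).
     if l = 1 then ((x + 1) mod n, y)
     else if l = 2 then (x, (y + 1) mod n)
     else if l = 3 then ((x + y) mod n, y)
     else if l = 4 then (x, (x + y) mod n)
     else (x, y))"

definition torus_map_inv :: "int \<Rightarrow> nat \<Rightarrow> int \<times> int \<Rightarrow> int \<times> int" where
  "torus_map_inv n l = (\<lambda>(x, y).
     if l = 1 then ((x - 1) mod n, y)
     else if l = 2 then (x, (y - 1) mod n)
     else if l = 3 then ((x - y) mod n, y)
     else if l = 4 then (x, (y - x) mod n)
     else (x, y))"

lemma sum_deviation_from_mean:
  fixes f :: "'b \<Rightarrow> real"
  assumes "finite A"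
  shows "(\<Sum>x\<in>A. f x - (\<Sum>y\<in>A. f y) / real (card A)) = 0"
  using assms by (cases "A = {}") (simp_all add: sum_subtractf)

lemma torus_map_poincare:
  fixes r :: int and \<phi> :: "int \<times> int \<Rightarrow> real"
  assumes r: "r > 0"
  defines "Z \<equiv> {0..<8 * r} \<times> {0..<8 * r}"
  shows "\<exists>a. (\<Sum>z\<in>Z. (\<phi> z - a)\<^sup>2) \<le> 14 * (\<Sum>l<5. \<Sum>z\<in>Z. (\<phi> (torus_map (8 * r) l z) - \<phi> z)\<^sup>2)"
proof -
  let ?D = "{0..<8 * r}"
  define a where "a = (\<Sum>z\<in>Z. \<phi> z) / real (card Z)"
  define f where "f x y = \<phi> (x mod (8 * r), y mod (8 * r)) - a" for x y
  have Z: "(\<Sum>z\<in>Z. \<chi> z) = (\<Sum>x\<in>?D. \<Sum>y\<in>?D. \<chi> (x, y))" for \<chi> :: "int \<times> int \<Rightarrow> real"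
    unfolding Z_def by (simp add: sum.cartesian_product)
  have fin: "finite Z" by (simp add: Z_def)
  have "(\<Sum>x\<in>?D. \<Sum>y\<in>?D. f x y) = (\<Sum>z\<in>Z. \<phi> z - a)"
    unfolding Z by (intro sum.cong refl) (simp add: f_def)
  also have "\<dots> = 0" unfolding a_def by (rule sum_deviation_from_mean[OF fin])
  finally have mean: "(\<Sum>x\<in>?D. \<Sum>y\<in>?D. f x y) = 0" .
  have "(\<Sum>z\<in>Z. (\<phi> z - a)\<^sup>2) = (\<Sum>x\<in>?D. \<Sum>y\<in>?D. (f x y)\<^sup>2)"
    unfolding Z by (intro sum.cong refl) (simp add: f_def)
  also have "\<dots> \<le> 14 *
     ((\<Sum>x\<in>?D. \<Sum>y\<in>?D. (f (x + 1) y - f x y)\<^sup>2)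
    + (\<Sum>x\<in>?D. \<Sum>y\<in>?D. (f x (y + 1) - f x y)\<^sup>2)
    + (\<Sum>x\<in>?D. \<Sum>y\<in>?D. (f (x + y) y - f x y)\<^sup>2)
    + (\<Sum>x\<in>?D. \<Sum>y\<in>?D. (f x (x + y) - f x y)\<^sup>2))"
    by (rule torus_poincare[OF r _ _ mean]) (simp_all add: f_def)
  also have "\<dots> = 14 * (\<Sum>l<5. \<Sum>z\<in>Z. (\<phi> (torus_map (8 * r) l z) - \<phi> z)\<^sup>2)"
    unfolding Z by (simp add: eval_nat_numeral torus_map_def f_def)
  finally show ?thesis by blast
qed

text \<open>The constant does not depend on r; the size is 2 * (8 r)^2. Five involutions carry the
  expansion, but all indices are covered because every fiber position of the final graph needs a
  matching edge: for l \<ge> 5 the constructed map merely swaps the two copies.\<close>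

lemma expander_involutions:
  "\<exists>C::real > 0. \<forall>r::nat. r > 0 \<longrightarrow>
     (\<exists>(W :: ((int \<times> int) \<times> bool) set) \<sigma>.
        finite W \<and> card W = 128 * r\<^sup>2 \<and>
        (\<forall>l. \<forall>w\<in>W. \<sigma> l w \<in> W \<and> \<sigma> l (\<sigma> l w) = w \<and> \<sigma> l w \<noteq> w) \<and>
        (\<forall>\<psi>::(int \<times> int) \<times> bool \<Rightarrow> real.
           \<exists>a. (\<Sum>w\<in>W. (\<psi> w - a)\<^sup>2) \<le> C * (\<Sum>l<5::nat. \<Sum>w\<in>W. (\<psi> (\<sigma> l w) - \<psi> w)\<^sup>2)))"
proof (intro exI[of _ "12 * real 5 * 14 + 2"] conjI allI impI)
  fix r :: nat assume r: "r > 0"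
  define n where "n = 8 * int r"
  define Z where "Z = {0..<n} \<times> {0..<n}"
  let ?\<sigma> = "double_involution (torus_map n) (torus_map_inv n)"
  have n: "n > 0" using r by (simp add: n_def)
  have g: "torus_map n l z \<in> Z" "torus_map_inv n l z \<in> Z"
    "torus_map_inv n l (torus_map n l z) = z" "torus_map n l (torus_map_inv n l z) = z" if "z \<in> Z" for l z
    using that n by (auto simp: Z_def torus_map_def torus_map_inv_def mod_diff_left_eq mod_add_left_eq mod_add_right_eq mod_diff_right_eq)
  have fin: "finite Z" by (simp add: Z_def)
  show "\<exists>(W :: ((int \<times> int) \<times> bool) set) \<sigma>.
        finite W \<and> card W = 128 * r\<^sup>2 \<and>
        (\<forall>l. \<forall>w\<in>W. \<sigma> l w \<in> W \<and> \<sigma> l (\<sigma> l w) = w \<and> \<sigma> l w \<noteq> w) \<and>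
        (\<forall>\<psi>::(int \<times> int) \<times> bool \<Rightarrow> real.
           \<exists>a. (\<Sum>w\<in>W. (\<psi> w - a)\<^sup>2) \<le> (12 * real 5 * 14 + 2) * (\<Sum>l<5::nat. \<Sum>w\<in>W. (\<psi> (\<sigma> l w) - \<psi> w)\<^sup>2))"
  proof (intro exI[of _ "Z \<times> UNIV"] exI[of _ ?\<sigma>] conjI allI ballI)
    show "card (Z \<times> (UNIV::bool set)) = 128 * r\<^sup>2"
      by (simp add: Z_def card_cartesian_product n_def nat_mult_distrib power2_eq_square)
    fix l and w :: "(int \<times> int) \<times> bool" assume "w \<in> Z \<times> UNIV"
    then have w: "fst w \<in> Z" by auto
    show "?\<sigma> l w \<in> Z \<times> UNIV" "?\<sigma> l (?\<sigma> l w) = w" "?\<sigma> l w \<noteq> w"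
      using g[OF w, of l] w by (auto simp: double_involution_def prod_eq_iff split: if_splits)
  next
    fix \<psi> :: "(int \<times> int) \<times> bool \<Rightarrow> real"
    show "\<exists>a. (\<Sum>w\<in>Z \<times> UNIV. (\<psi> w - a)\<^sup>2)
      \<le> (12 * real 5 * 14 + 2) * (\<Sum>l<5. \<Sum>w\<in>Z \<times> UNIV. (\<psi> (?\<sigma> l w) - \<psi> w)\<^sup>2)"
    proof (rule double_involution_poincare[OF fin _ _ g])
      show "\<exists>a. (\<Sum>z\<in>Z. (\<phi> z - a)\<^sup>2) \<le> 14 * (\<Sum>l<5. \<Sum>z\<in>Z. (\<phi> (torus_map n l z) - \<phi> z)\<^sup>2)" for \<phi> :: "int \<times> int \<Rightarrow> real"
        using torus_map_poincare[of "int r" \<phi>] r by (simp add: Z_def n_def)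
      show "torus_map n 0 z = z" for z by (simp add: torus_map_def split: prod.splits)
    qed auto
  qed (use fin in auto)
qed simp

section \<open>Courant-Fischer bounds\<close>

lemma symmetric_mat_entry:
  assumes "A \<in> carrier_mat n n" "A\<^sup>T = A" "i < n" "j < n"
  shows "A $$ (i, j) = A $$ (j, i)"
  using assms by (metis carrier_matD index_transpose_mat(1))

text \<open>A complex eigenvalue exists. By symmetry the Hermitian form \<open>s\<close> of its
  eigenvector equals its own conjugate, and \<open>s\<close> is the eigenvalue times a positive
  number, so the eigenvalue is real and a root of the real characteristic polynomial.\<close>

lemma symmetric_has_real_eigenvalue:
  fixes A :: "real mat"
  assumes A: "A \<in> carrier_mat n n" and sym: "A\<^sup>T = A" and n: "n > 0"
  shows "\<exists>e. eigenvalue A e"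
proof -
  let ?B = "map_mat complex_of_real A"
  have B: "?B \<in> carrier_mat n n" using A by simp
  obtain k where k: "eigenvalue ?B k"
    using spectrum_non_empty[OF B n] by (auto simp: spectrum_def)
  then obtain v where v: "v \<in> carrier_vec n" "v \<noteq> 0\<^sub>v n" "?B *\<^sub>v v = k \<cdot>\<^sub>v v"
    using B by (auto simp: eigenvalue_def eigenvector_def)
  have row: "(\<Sum>j<n. complex_of_real (A $$ (i, j)) * v $ j) = k * v $ i" if "i < n" for i
  proof -
    have "(\<Sum>j<n. complex_of_real (A $$ (i, j)) * v $ j) = row ?B i \<bullet> v"
      unfolding scalar_prod_def using that A v(1) by (intro sum.cong) auto
    also have "\<dots> = (?B *\<^sub>v v) $ i" using that A by simp
    also have "\<dots> = k * v $ i" unfolding v(3) using that v(1) by simp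
    finally show ?thesis .
  qed
  define s where "s = (\<Sum>i<n. \<Sum>j<n. complex_of_real (A $$ (i, j)) * v $ j * cnj (v $ i))"
  define N where "N = (\<Sum>i<n. (norm (v $ i))\<^sup>2)"
  have "s = (\<Sum>i<n. k * v $ i * cnj (v $ i))"
    unfolding s_def by (intro sum.cong refl) (simp add: row flip: sum_distrib_right)
  then have s1: "s = k * of_real N"
    by (simp add: N_def sum_distrib_left complex_norm_square mult.assoc flip: of_real_power)
  have "cnj s = (\<Sum>i<n. \<Sum>j<n. complex_of_real (A $$ (i, j)) * cnj (v $ j) * v $ i)"
    by (simp add: s_def)
  also have "\<dots> = (\<Sum>j<n. \<Sum>i<n. complex_of_real (A $$ (i, j)) * cnj (v $ j) * v $ i)"
    by (rule sum.swap)
  also have "\<dots> = s" unfolding s_def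
    by (intro sum.cong refl) (simp add: symmetric_mat_entry[OF A sym] mult_ac)
  finally have "cnj k * of_real N = k * of_real N" using s1 by (metis complex_cnj_complex_of_real complex_cnj_mult)
  moreover have "N \<noteq> 0"
  proof -
    obtain i where "i < n" "v $ i \<noteq> 0" using v(1,2)
      by (metis carrier_vecD eq_vecI index_zero_vec(1) index_zero_vec(2))
    then show ?thesis unfolding N_def by (auto simp: sum_nonneg_eq_0_iff)
  qed
  ultimately have "cnj k = k" by simp
  then have "k = of_real (Re k)" by (simp add: complex_eq_iff)
  moreover have "poly (char_poly ?B) k = 0" using k eigenvalue_root_char_poly[OF B] by simp
  ultimately have "poly (map_poly complex_of_real (char_poly A)) (of_real (Re k)) = 0"
    using of_real_hom.char_poly_hom[OF A, where ?'a = complex] by simp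
  then have "poly (char_poly A) (Re k) = 0" by simp
  then show ?thesis using eigenvalue_root_char_poly[OF A] by blast
qed

text \<open>Complete v to a basis, orthogonalise by Gram-Schmidt, which keeps the first vector, and
  normalise; by the last step column 0 is only a multiple of v.\<close>

lemma orthonormal_extension:
  fixes v :: "real vec"
  assumes v: "v \<in> carrier_vec n" and v0: "v \<noteq> 0\<^sub>v n" and n: "n > 0"
  shows "\<exists>W c. W \<in> carrier_mat n n \<and> W\<^sup>T * W = 1\<^sub>m n \<and> col W 0 = c \<cdot>\<^sub>v v"
proof -
  interpret cof_vec_space n "TYPE(real)" .
  define b where "b = basis_completion v"
  define ws where "ws = gram_schmidt n b"
  note bc = basis_completion[OF v v0, folded b_def]
  have ws: "set ws \<subseteq> carrier_vec n" "corthogonal ws" "length ws = n"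
    using gram_schmidt_result[OF bc(2,4,5) ws_def] bc(6) by auto
  obtain vs where "b = v # vs" using bc(6,7) n by (cases b) auto
  then have hd: "ws ! 0 = v"
    using gram_schmidt_hd[OF v, of vs] ws(3) n by (metis hd_conv_nth length_greater_0_conv ws_def)
  have cj: "conjugate w = w" for w :: "real vec" by (auto simp: vec_eq_iff conjugate_vec_def)
  have orth: "ws ! i \<bullet> ws ! j = 0 \<longleftrightarrow> i \<noteq> j" if "i < n" "j < n" for i j
    using corthogonalD[OF ws(2)] that ws(3) by (simp add: cj)
  define u where "u i = (1 / sqrt (ws ! i \<bullet> ws ! i)) \<cdot>\<^sub>v ws ! i" for i
  have wc: "ws ! i \<in> carrier_vec n" if "i < n" for i using ws that by auto
  have uc: "u i \<in> carrier_vec n" if "i < n" for i using wc[OF that] by (simp add: u_def)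
  have uu: "u i \<bullet> u j = (if i = j then 1 else 0)" if "i < n" "j < n" for i j
  proof -
    have "u i \<bullet> u j = (ws ! i \<bullet> ws ! j) / (sqrt (ws ! i \<bullet> ws ! i) * sqrt (ws ! j \<bullet> ws ! j))"
      using wc[OF that(1)] wc[OF that(2)] by (simp add: u_def)
    moreover have "ws ! i \<bullet> ws ! i > 0"
      using orth[OF that(1) that(1)] by (simp add: scalar_prod_def order_less_le sum_nonneg)
    ultimately show ?thesis using orth[OF that] by auto
  qed
  let ?W = "mat_of_cols n (map u [0..<n])"
  have W: "?W \<in> carrier_mat n n" using mat_of_cols_carrier(1)[of n "map u [0..<n]"] by simp
  have col: "col ?W i = u i" if "i < n" for i
    using that uc by (subst col_mat_of_cols) auto
  have "?W\<^sup>T * ?W = 1\<^sub>m n"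
    by (rule eq_matI) (use W uu in \<open>auto simp: col\<close>)
  moreover have "col ?W 0 = (1 / sqrt (ws ! 0 \<bullet> ws ! 0)) \<cdot>\<^sub>v v" using col[OF n] by (simp add: u_def hd)
  ultimately show ?thesis using W by blast
qed

text \<open>In an orthonormal basis that starts with an eigenvector, column 0 is e times the first
  unit vector, and symmetry clears the rest of row 0 as well.\<close>

lemma symmetric_deflate:
  fixes A :: "real mat"
  assumes A: "A \<in> carrier_mat (Suc m) (Suc m)" and sym: "A\<^sup>T = A"
  shows "\<exists>W e B. W \<in> carrier_mat (Suc m) (Suc m) \<and> W\<^sup>T * W = 1\<^sub>m (Suc m) \<and>
      B \<in> carrier_mat m m \<and> B\<^sup>T = B \<and>
      A * W = W * four_block_mat (mat 1 1 (\<lambda>_. e)) (0\<^sub>m 1 m) (0\<^sub>m m 1) B"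
proof -
  let ?n = "Suc m"
  obtain e where "eigenvalue A e" using symmetric_has_real_eigenvalue[OF A sym] by auto
  then obtain v where v: "v \<in> carrier_vec ?n" "v \<noteq> 0\<^sub>v ?n" "A *\<^sub>v v = e \<cdot>\<^sub>v v"
    using A by (auto simp: eigenvalue_def eigenvector_def)
  obtain W c where W: "W \<in> carrier_mat ?n ?n" "W\<^sup>T * W = 1\<^sub>m ?n" and c: "col W 0 = c \<cdot>\<^sub>v v"
    using orthonormal_extension[OF v(1,2)] by auto
  have WT: "W\<^sup>T \<in> carrier_mat ?n ?n" using W by simp
  have WW: "W * W\<^sup>T = 1\<^sub>m ?n" by (rule mat_mult_left_right_inverse[OF WT W])
  define A' where "A' = W\<^sup>T * (A * W)"
  have A': "A' \<in> carrier_mat ?n ?n" using W A by (simp add: A'_def)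
  have AW: "A * W = W * A'"
  proof -
    have "W * A' = (W * W\<^sup>T) * (A * W)" unfolding A'_def
      using W WT A by (intro assoc_mult_mat[symmetric]) auto
    then show ?thesis using WW A W by simp
  qed
  have sA': "A'\<^sup>T = A'"
  proof -
    have "A'\<^sup>T = (A * W)\<^sup>T * W" unfolding A'_def
      using W WT A by (subst transpose_mult) auto
    also have "(A * W)\<^sup>T = W\<^sup>T * A" using transpose_mult[OF A W(1)] sym by simp
    finally show ?thesis unfolding A'_def using W WT A by (simp add: assoc_mult_mat)
  qed
  have "A *\<^sub>v col W 0 = e \<cdot>\<^sub>v col W 0"
    unfolding c using v A by (simp add: mult_mat_vec smult_smult_assoc mult.commute)
  have col0: "A' $$ (i, 0) = (if i = 0 then e else 0)" if i: "i < ?n" for i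
  proof -
    have "A' $$ (i, 0) = col W i \<bullet> col (A * W) 0"
      unfolding A'_def using W A i by simp
    also have "col (A * W) 0 = e \<cdot>\<^sub>v col W 0"
      using col_mult2[OF A W(1) zero_less_Suc] \<open>A *\<^sub>v col W 0 = e \<cdot>\<^sub>v col W 0\<close> by metis
    also have "col W i \<bullet> (e \<cdot>\<^sub>v col W 0) = e * (W\<^sup>T * W) $$ (i, 0)"
      using W(1) i by simp
    finally show ?thesis unfolding W(2) using i by simp
  qed
  define B where "B = mat m m (\<lambda>(i, j). A' $$ (Suc i, Suc j))"
  have "A' = four_block_mat (mat 1 1 (\<lambda>_. e)) (0\<^sub>m 1 m) (0\<^sub>m m 1) B"
  proof (rule eq_matI)
    fix i j assume "i < dim_row (four_block_mat (mat 1 1 (\<lambda>_. e)) (0\<^sub>m 1 m) (0\<^sub>m m 1) B)"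
      "j < dim_col (four_block_mat (mat 1 1 (\<lambda>_. e)) (0\<^sub>m 1 m) (0\<^sub>m m 1) B)"
    then have ij: "i < ?n" "j < ?n" by (auto simp: B_def)
    then show "A' $$ (i, j) = four_block_mat (mat 1 1 (\<lambda>_. e)) (0\<^sub>m 1 m) (0\<^sub>m m 1) B $$ (i, j)"
      using col0[OF ij(1)] col0[OF ij(2)] symmetric_mat_entry[OF A' sA', of 0 j]
      by (cases i; cases j) (auto simp: B_def)
  qed (use A' in \<open>auto simp: B_def\<close>)
  moreover have "B\<^sup>T = B"
    by (rule eq_matI) (auto simp: B_def intro: symmetric_mat_entry[OF A' sA'])
  ultimately show ?thesis using W AW by (intro exI[of _ W] exI[of _ e] exI[of _ B]) (auto simp: B_def)
qed

lemma symmetric_diagonalization: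
  fixes A :: "real mat"
  assumes "A \<in> carrier_mat n n" and "A\<^sup>T = A"
  shows "\<exists>P D. P \<in> carrier_mat n n \<and> D \<in> carrier_mat n n \<and> diagonal_mat D \<and>
      P\<^sup>T * P = 1\<^sub>m n \<and> A * P = P * D"
  using assms
proof (induction n arbitrary: A)
  case 0
  then show ?case by (intro exI[of _ "1\<^sub>m 0"] exI[of _ A]) (auto simp: diagonal_mat_def)
next
  case (Suc m)
  let ?n = "Suc m"
  obtain W e B where W: "W \<in> carrier_mat ?n ?n" "W\<^sup>T * W = 1\<^sub>m ?n"
    and B: "B \<in> carrier_mat m m" "B\<^sup>T = B"
    and AW: "A * W = W * four_block_mat (mat 1 1 (\<lambda>_. e)) (0\<^sub>m 1 m) (0\<^sub>m m 1) B"
    using symmetric_deflate[OF Suc.prems] by blast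
  obtain P D where P: "P \<in> carrier_mat m m" "P\<^sup>T * P = 1\<^sub>m m"
    and D: "D \<in> carrier_mat m m" "diagonal_mat D" and BP: "B * P = P * D"
    using Suc.IH[OF B] by blast
  let ?E = "mat 1 1 (\<lambda>_. e)"
  let ?P = "four_block_mat (1\<^sub>m 1) (0\<^sub>m 1 m) (0\<^sub>m m 1) P"
  let ?D = "four_block_mat ?E (0\<^sub>m 1 m) (0\<^sub>m m 1) D"
  let ?B = "four_block_mat ?E (0\<^sub>m 1 m) (0\<^sub>m m 1) B"
  have cP: "?P \<in> carrier_mat ?n ?n" and cD: "?D \<in> carrier_mat ?n ?n" and cB: "?B \<in> carrier_mat ?n ?n"
    using four_block_carrier_mat[of _ 1 1 _ m m] P(1) D(1) B(1) by auto
  have PT: "?P\<^sup>T = four_block_mat (1\<^sub>m 1) (0\<^sub>m 1 m) (0\<^sub>m m 1) P\<^sup>T"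
    using P(1) by (subst transpose_four_block_mat[of _ 1 1 _ m _ m]) simp_all
  have PP: "?P\<^sup>T * ?P = 1\<^sub>m ?n"
  proof -
    have "?P\<^sup>T * ?P = four_block_mat (1\<^sub>m 1 * 1\<^sub>m 1 + 0\<^sub>m 1 m * 0\<^sub>m m 1) (1\<^sub>m 1 * 0\<^sub>m 1 m + 0\<^sub>m 1 m * P)
        (0\<^sub>m m 1 * 1\<^sub>m 1 + P\<^sup>T * 0\<^sub>m m 1) (0\<^sub>m m 1 * 0\<^sub>m 1 m + P\<^sup>T * P)"
      unfolding PT using P(1) by (intro mult_four_block_mat) auto
    also have "\<dots> = four_block_mat (1\<^sub>m 1) (0\<^sub>m 1 m) (0\<^sub>m m 1) (1\<^sub>m m)"
      unfolding P(2) using P(1) by simp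
    finally show ?thesis by simp
  qed
  have BPD: "?B * ?P = ?P * ?D"
  proof -
    have "?B * ?P = four_block_mat (?E * 1\<^sub>m 1 + 0\<^sub>m 1 m * 0\<^sub>m m 1) (?E * 0\<^sub>m 1 m + 0\<^sub>m 1 m * P)
        (0\<^sub>m m 1 * 1\<^sub>m 1 + B * 0\<^sub>m m 1) (0\<^sub>m m 1 * 0\<^sub>m 1 m + B * P)"
      using P(1) B(1) by (intro mult_four_block_mat) auto
    also have "\<dots> = four_block_mat (1\<^sub>m 1 * ?E + 0\<^sub>m 1 m * 0\<^sub>m m 1) (1\<^sub>m 1 * 0\<^sub>m 1 m + 0\<^sub>m 1 m * D)
        (0\<^sub>m m 1 * ?E + P * 0\<^sub>m m 1) (0\<^sub>m m 1 * 0\<^sub>m 1 m + P * D)"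
      unfolding BP using P(1) B(1) D(1) by (intro cong_four_block_mat) auto
    also have "\<dots> = ?P * ?D"
      using P(1) D(1) by (intro mult_four_block_mat[symmetric]) auto
    finally show ?thesis .
  qed
  have cW: "W\<^sup>T \<in> carrier_mat ?n ?n" and cPT: "?P\<^sup>T \<in> carrier_mat ?n ?n" using W cP by auto
  have "(W * ?P)\<^sup>T * (W * ?P) = 1\<^sub>m ?n"
  proof -
    have "(W * ?P)\<^sup>T * (W * ?P) = (?P\<^sup>T * W\<^sup>T) * (W * ?P)"
      using transpose_mult[OF W(1) cP] by simp
    also have "\<dots> = ?P\<^sup>T * (W\<^sup>T * (W * ?P))"
      using cPT cW W cP by (intro assoc_mult_mat) auto
    also have "W\<^sup>T * (W * ?P) = (W\<^sup>T * W) * ?P"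
      using cW W cP by (intro assoc_mult_mat[symmetric]) auto
    finally show ?thesis unfolding W(2) left_mult_one_mat[OF cP] PP .
  qed
  moreover have "A * (W * ?P) = W * ?P * ?D"
  proof -
    have "A * (W * ?P) = (A * W) * ?P"
      using Suc.prems(1) W cP by (intro assoc_mult_mat[symmetric]) auto
    also have "\<dots> = W * (?B * ?P)"
      unfolding AW using W cB cP by (intro assoc_mult_mat) auto
    also have "\<dots> = (W * ?P) * ?D"
      unfolding BPD using W cP cD by (intro assoc_mult_mat[symmetric]) auto
    finally show ?thesis .
  qed
  moreover have "diagonal_mat ?D"
    unfolding diagonal_mat_def
  proof (intro allI impI)
    fix i j assume "i < dim_row ?D" "j < dim_col ?D" "i \<noteq> j"
    then show "?D $$ (i, j) = 0" using D by (simp add: diagonal_mat_def)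
  qed
  ultimately show ?case using mult_carrier_mat[OF W(1) cP] cD by blast
qed

section \<open>Eigenvalue bounds from quadratic forms\<close>

text \<open>Fewer than n linear equations in n unknowns. Padding by zero rows makes the system
  square, and the zero row at index \<open>length cs\<close> forces determinant 0.\<close>

lemma common_orthogonal_vector:
  fixes cs :: "real vec list"
  assumes "set cs \<subseteq> carrier_vec n" and len: "length cs < n"
  shows "\<exists>x \<in> carrier_vec n. x \<noteq> 0\<^sub>v n \<and> (\<forall>c\<in>set cs. c \<bullet> x = 0)"
proof -
  define c where "c i = (if i < length cs then cs ! i else 0\<^sub>v n)" for i
  have c: "c i \<in> carrier_vec n" for i 
    using assms(1) by (auto simp: c_def)
  define M where "M = mat\<^sub>r n n c"
  have M: "M \<in> carrier_mat n n" by (simp add: M_def)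
  have row: "row M i = c i" if "i < n" for i
    unfolding M_def using that c[of i] by (intro row_mat_of_row_fun) auto
  have "M = mat\<^sub>r n n (\<lambda>i. if i = length cs then 0\<^sub>v n else c i)"
    unfolding M_def by (rule arg_cong[of _ _ "mat\<^sub>r n n"]) (auto simp: c_def)
  then have "det M = 0" using det_row_0[OF len, of c] c by simp
  then obtain x where x: "x \<in> carrier_vec n" "x \<noteq> 0\<^sub>v n" "M *\<^sub>v x = 0\<^sub>v n"
    using det_0_iff_vec_prod_zero_field[OF M] by blast
  have "a \<bullet> x = 0" if a: "a \<in> set cs" for a
  proof -
    obtain i where i: "i < length cs" "a = cs ! i" using a by (metis in_set_conv_nth)
    have "a \<bullet> x = (M *\<^sub>v x) $ i" using row[of i] len M i by (simp add: c_def)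
    also have "\<dots> = 0" unfolding x(3) using i len by simp
    finally show ?thesis .
  qed
  then show ?thesis using x(1,2) by (intro bexI[of _ x]) simp_all
qed

lemma ith_eigenvalue_eq_sort:
  fixes A :: "real mat"
  assumes A: "A \<in> carrier_mat n n" and P: "P \<in> carrier_mat n n" "P\<^sup>T * P = 1\<^sub>m n"
    and D: "D \<in> carrier_mat n n" "diagonal_mat D" and AP: "A * P = P * D"
  shows "ith_eigenvalue (r + 1) A = sort (map (\<lambda>i. D $$ (i, i)) [0..<n]) ! r"
proof -
  have PT: "P\<^sup>T \<in> carrier_mat n n" using P by simp
  have PP: "P * P\<^sup>T = 1\<^sub>m n" by (rule mat_mult_left_right_inverse[OF PT P])
  have "A = A * (P * P\<^sup>T)" using A PP by simp
  also have "\<dots> = P * D * P\<^sup>T" using assoc_mult_mat[OF A P(1) PT] AP by simp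
  finally have "similar_mat A D"
    using A P D PT PP by (intro similar_matI[of _ _ P "P\<^sup>T" n]) auto
  then have "char_poly A = char_poly D" by (rule char_poly_similar)
  also have "upper_triangular D" using D by (auto simp: diagonal_mat_def)
  then have "char_poly D = (\<Prod>a\<leftarrow>diag_mat D. [:- a, 1:])"
    by (rule char_poly_upper_triangular[OF D(1)])
  also have "diag_mat D = map (\<lambda>i. D $$ (i, i)) [0..<n]" using D by (simp add: diag_mat_def)
  finally have cp: "char_poly A = (\<Prod>a\<leftarrow>map (\<lambda>i. D $$ (i, i)) [0..<n]. [:- a, 1:])" .
  have pr: "proots (\<Prod>a\<leftarrow>es. [:- a, 1:]) = mset es" for es :: "real list"
  proof (induction es)
    case (Cons e es)
    have "(\<Prod>a\<leftarrow>es. [:- a, 1:]) \<noteq> 0" by (auto simp: prod_list_zero_iff)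
    then have "proots ([:- e, 1:] * (\<Prod>a\<leftarrow>es. [:- a, 1:])) = {#e#} + mset es"
      by (subst proots_mult) (use Cons in auto)
    then show ?case by simp
  qed simp
  show ?thesis unfolding ith_eigenvalue_def cp pr sorted_list_of_multiset_mset by simp
qed

lemma quadratic_form_diagonalized:
  fixes A :: "real mat"
  assumes A: "A \<in> carrier_mat n n" and P: "P \<in> carrier_mat n n" "P\<^sup>T * P = 1\<^sub>m n"
    and D: "D \<in> carrier_mat n n" "diagonal_mat D" and AP: "A * P = P * D"
    and x: "x \<in> carrier_vec n"
  shows "x \<bullet> x = (\<Sum>i<n. (col P i \<bullet> x)\<^sup>2)"
    and "x \<bullet> (A *\<^sub>v x) = (\<Sum>i<n. D $$ (i, i) * (col P i \<bullet> x)\<^sup>2)"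
proof -
  have PT: "P\<^sup>T \<in> carrier_mat n n" using P by simp
  have PP: "P * P\<^sup>T = 1\<^sub>m n" by (rule mat_mult_left_right_inverse[OF PT P])
  define z where "z = P\<^sup>T *\<^sub>v x"
  have z: "z \<in> carrier_vec n" "\<And>i. i < n \<Longrightarrow> z $ i = col P i \<bullet> x"
    using P(1) x by (auto simp: z_def)
  have xz: "x = P *\<^sub>v z" unfolding z_def
    using assoc_mult_mat_vec[OF P(1) PT x] PP x by simp
  have Pz: "x \<bullet> (P *\<^sub>v y) = z \<bullet> y" if "y \<in> carrier_vec n" for y
    unfolding z_def using transpose_vec_mult_scalar[OF P(1) that x] by simp
  show "x \<bullet> x = (\<Sum>i<n. (col P i \<bullet> x)\<^sup>2)"
  proof -
    have "x \<bullet> x = z \<bullet> z" using Pz[OF z(1)] xz by metis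
    then show ?thesis using z by (simp add: scalar_prod_def lessThan_atLeast0 power2_eq_square)
  qed
  have "A *\<^sub>v x = P *\<^sub>v (D *\<^sub>v z)"
    using xz assoc_mult_mat_vec[OF A P(1) z(1)] assoc_mult_mat_vec[OF P(1) D(1) z(1)] AP by metis
  then have "x \<bullet> (A *\<^sub>v x) = z \<bullet> (D *\<^sub>v z)" using Pz D z by simp
  also have "\<dots> = (\<Sum>i<n. D $$ (i, i) * (z $ i)\<^sup>2)"
  proof -
    have "(D *\<^sub>v z) $ i = D $$ (i, i) * z $ i" if i: "i < n" for i
    proof -
      have "(D *\<^sub>v z) $ i = (\<Sum>j<n. D $$ (i, j) * z $ j)"
        using D z i by (simp add: scalar_prod_def lessThan_atLeast0)
      also have "\<dots> = (\<Sum>j<n. if j = i then D $$ (i, i) * z $ i else 0)"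
        using D i by (intro sum.cong refl) (auto simp: diagonal_mat_def)
      finally show ?thesis using i by simp
    qed
    then show ?thesis using D z by (simp add: scalar_prod_def lessThan_atLeast0 power2_eq_square mult_ac)
  qed
  finally show "x \<bullet> (A *\<^sub>v x) = (\<Sum>i<n. D $$ (i, i) * (col P i \<bullet> x)\<^sup>2)" using z by simp
qed

lemma card_small_entries:
  fixes xs :: "real list"
  assumes r: "r < length xs" and lt: "sort xs ! r < c"
  shows "r < card {i. i < length xs \<and> xs ! i < c}"
proof -
  have "r < card {i. i < length (sort xs) \<and> sort xs ! i < c}"
  proof -
    have "{..r} \<subseteq> {i. i < length (sort xs) \<and> sort xs ! i < c}"
      using r lt sorted_nth_mono[OF sorted_sort, of _ r xs] by fastforce
    from card_mono[OF _ this] show ?thesis by simp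
  qed
  also have "\<dots> = length (filter (\<lambda>x. x < c) (sort xs))" by (simp add: length_filter_conv_card)
  also have "\<dots> = length (filter (\<lambda>x. x < c) xs)"
    by (metis mset_filter mset_sort size_mset)
  finally show ?thesis by (simp add: length_filter_conv_card)
qed

text \<open>If the eigenvalue were below \<epsilon>, more than r members of an orthonormal
  eigenbasis would have eigenvalues below \<epsilon>. Orthogonality to the other members and to the
  r vectors \<open>cs\<close> is then fewer than n conditions, and a nonzero solution violates
  \<open>form\<close>.\<close>

lemma ith_eigenvalue_ge:
  fixes A :: "real mat" and cs :: "real vec list"
  assumes A: "A \<in> carrier_mat n n" "A\<^sup>T = A" and r: "r < n"
    and cs: "set cs \<subseteq> carrier_vec n" "length cs = r"
    and form: "\<And>x. x \<in> carrier_vec n \<Longrightarrow> (\<forall>c\<in>set cs. c \<bullet> x = 0) \<Longrightarrow> \<epsilon> * (x \<bullet> x) \<le> x \<bullet> (A *\<^sub>v x)"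
  shows "\<epsilon> \<le> ith_eigenvalue (r + 1) A"
proof (rule ccontr)
  obtain P D where PD: "P \<in> carrier_mat n n" "P\<^sup>T * P = 1\<^sub>m n"
      "D \<in> carrier_mat n n" "diagonal_mat D" "A * P = P * D"
    using symmetric_diagonalization[OF A] by blast
  let ?l = "map (\<lambda>i. D $$ (i, i)) [0..<n]"
  assume "\<not> \<epsilon> \<le> ith_eigenvalue (r + 1) A"
  then have "sort ?l ! r < \<epsilon>" using ith_eigenvalue_eq_sort[OF A(1) PD] by simp
  from card_small_entries[OF _ this] r
  have "r < card {i. i < n \<and> D $$ (i, i) < \<epsilon>}" by (simp cong: conj_cong)
  moreover define I where "I = [i \<leftarrow> [0..<n]. \<not> D $$ (i, i) < \<epsilon>]"
  moreover have "length I + card {i. i < n \<and> D $$ (i, i) < \<epsilon>} = n"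
    unfolding I_def using sum_length_filter_compl[of "\<lambda>i. D $$ (i, i) < \<epsilon>" "[0..<n]"]
    by (simp add: length_filter_conv_card cong: conj_cong)
  ultimately have len: "length (cs @ map (col P) I) < n" using cs by simp
  have "set (cs @ map (col P) I) \<subseteq> carrier_vec n" using cs PD(1) by auto
  from common_orthogonal_vector[OF this len] obtain x where x: "x \<in> carrier_vec n" "x \<noteq> 0\<^sub>v n"
    "\<forall>c\<in>set cs. c \<bullet> x = 0" "\<forall>i\<in>set I. col P i \<bullet> x = 0" by auto
  note q = quadratic_form_diagonalized[OF A(1) PD x(1)]
  have xx: "x \<bullet> x > 0"
  proof -
    obtain i where i: "i < n" "x $ i \<noteq> 0" using x(1,2)
      by (metis carrier_vecD eq_vecI index_zero_vec(1) index_zero_vec(2))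
    then have "0 < x $ i * x $ i" using not_real_square_gt_zero by blast
    also have "\<dots> \<le> x \<bullet> x" unfolding scalar_prod_def
      using i x(1) by (intro member_le_sum) auto
    finally show ?thesis .
  qed
  have le: "D $$ (i, i) * (col P i \<bullet> x)\<^sup>2 \<le> \<epsilon> * (col P i \<bullet> x)\<^sup>2" if "i < n" for i
    using x(4) that by (cases "D $$ (i, i) < \<epsilon>") (auto simp: I_def intro: mult_right_mono)
  obtain j where j: "j < n" "col P j \<bullet> x \<noteq> 0"
    using xx unfolding q(1) by (metis (no_types, lifting) lessThan_iff less_irrefl power_zero_numeral sum.neutral)
  then have "D $$ (j, j) < \<epsilon>" using x(4) by (auto simp: I_def)
  then have "D $$ (j, j) * (col P j \<bullet> x)\<^sup>2 < \<epsilon> * (col P j \<bullet> x)\<^sup>2" using j by simp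
  then have "x \<bullet> (A *\<^sub>v x) < (\<Sum>i<n. \<epsilon> * (col P i \<bullet> x)\<^sup>2)"
    unfolding q(2) using le j(1) by (intro sum_strict_mono_ex1) auto
  also have "\<dots> = \<epsilon> * (x \<bullet> x)" unfolding q(1) by (simp add: sum_distrib_left)
  finally show False using form[OF x(1,3)] by simp
qed

text \<open>Serves to bound from above the set whose supremum is
  \<open>algebraic_connectivity\<close>, so that a single placement yields a lower bound for
  it.\<close>

lemma ith_eigenvalue_le:
  fixes A :: "real mat"
  assumes A: "A \<in> carrier_mat n n" "A\<^sup>T = A" and r: "r < n"
    and form: "\<And>x. x \<in> carrier_vec n \<Longrightarrow> x \<bullet> (A *\<^sub>v x) \<le> K * (x \<bullet> x)"
  shows "ith_eigenvalue (r + 1) A \<le> K"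
proof -
  obtain P D where PD: "P \<in> carrier_mat n n" "P\<^sup>T * P = 1\<^sub>m n"
      "D \<in> carrier_mat n n" "diagonal_mat D" "A * P = P * D"
    using symmetric_diagonalization[OF A] by blast
  let ?l = "map (\<lambda>i. D $$ (i, i)) [0..<n]"
  have "sort ?l ! r \<in> set (sort ?l)" using r by (intro nth_mem) simp
  then obtain i where i: "i < n" "sort ?l ! r = D $$ (i, i)" by auto
  have x: "col P i \<in> carrier_vec n" using PD(1) by auto
  have ji: "col P j \<bullet> col P i = (if j = i then 1 else 0)" if "j < n" for j
  proof -
    have "(P\<^sup>T * P) $$ (j, i) = col P j \<bullet> col P i" using PD(1) that i by simp
    then show ?thesis using PD(2) that i by simp
  qed
  have "D $$ (i, i) = (\<Sum>j<n. D $$ (j, j) * (col P j \<bullet> col P i)\<^sup>2)"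
    using i ji by (simp add: if_distrib[where f = "\<lambda>t. _ * t\<^sup>2"] cong: if_cong)
  also have "\<dots> = col P i \<bullet> (A *\<^sub>v col P i)"
    using quadratic_form_diagonalized(2)[OF A(1) PD x] by simp
  also have "\<dots> \<le> K" using form[OF x] ji[OF i(1)] by simp
  finally show ?thesis using ith_eigenvalue_eq_sort[OF A(1) PD] i by simp
qed

section \<open>The stiffness form\<close>

lemma sum_lessThan_mult:
  fixes f :: "nat \<Rightarrow> 'a::comm_monoid_add"
  shows "(\<Sum>i<n * d. f i) = (\<Sum>w<n. \<Sum>a<d. f (w * d + a))"
proof -
  have "(\<Sum>a<d. f (w * d + a)) = sum f {w * d..<w * d + d}" for w
    using sum.shift_bounds_nat_ivl[of f 0 "w * d" d] by (simp add: lessThan_atLeast0 add.commute)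
  then show ?thesis using sum.nat_group[of f d n] by simp
qed

lemma block_index_less:
  fixes w a n d :: nat
  assumes "w < n" "a < d"
  shows "w * d + a < d * n"
proof -
  have "w * d + a < Suc w * d" using assms(2) by simp
  also have "\<dots> \<le> n * d" using assms(1) by (intro mult_le_mono1) simp
  finally show ?thesis by (simp add: mult.commute)
qed

lemma scalar_prod_blocks:
  fixes x y :: "real vec"
  assumes "dim_vec x = d * n"
  shows "y \<bullet> x = (\<Sum>w<n. \<Sum>a<d. y $ (w * d + a) * x $ (w * d + a))"
  unfolding scalar_prod_def assms using sum_lessThan_mult[of "\<lambda>i. y $ i * x $ i" n d]
  by (simp add: lessThan_atLeast0 mult.commute)

text \<open>The stiffness form sums over a list of edges, the later estimates over a set of pairs;
  for nonnegative terms this direction holds even if entries repeat.\<close>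

lemma sum_set_le_sum_list:
  fixes f :: "'a \<Rightarrow> real"
  assumes "\<And>x. f x \<ge> 0"
  shows "(\<Sum>x\<in>set xs. f x) \<le> (\<Sum>x\<leftarrow>xs. f x)"
proof (induction xs)
  case (Cons y ys)
  then show ?case using assms[of y] by (simp add: sum.insert_if)
qed simp

lemma set_edge_list:
  assumes "finite V"
  shows "set (edge_list V E) = {(u, v). u \<in> V \<and> v \<in> V \<and> u < v \<and> {u, v} \<in> E}"
  using assms by (auto simp: edge_list_def)

lemma dim_direction:
  assumes "p v \<in> carrier_vec d"
  shows "dim_vec (direction d p u v) = d"
  using assms by (auto simp: direction_def)

lemma edge_vec_carrier:
  assumes "p v \<in> carrier_vec d"
  shows "edge_vec d V p u v \<in> carrier_vec (d * card V)"
  using dim_direction[where p = p, OF assms, of u]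
  by (intro carrier_vecI) (simp add: edge_vec_def kronecker_vec_def vertex_vec_def)

lemma rigidity_matrix_carrier:
  "rigidity_matrix d V E p \<in> carrier_mat (d * card V) (length (edge_list V E))"
  unfolding rigidity_matrix_def using mat_of_cols_carrier(1) by (metis length_map)

lemma stiffness_matrix_carrier:
  "stiffness_matrix d V E p \<in> carrier_mat (d * card V) (d * card V)"
  using rigidity_matrix_carrier[of d V E p] by (simp add: stiffness_matrix_def)

lemma stiffness_matrix_symmetric: "(stiffness_matrix d V E p)\<^sup>T = stiffness_matrix d V E p"
  unfolding stiffness_matrix_def
  by (subst transpose_mult[OF rigidity_matrix_carrier]) (use rigidity_matrix_carrier in auto)

lemma stiffness_form:
  assumes fin: "finite V" and p: "p \<in> V \<rightarrow> carrier_vec d" and x: "x \<in> carrier_vec (d * card V)"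
  shows "x \<bullet> (stiffness_matrix d V E p *\<^sub>v x) = (\<Sum>(u, v)\<leftarrow>edge_list V E. (edge_vec d V p u v \<bullet> x)\<^sup>2)"
proof -
  let ?R = "rigidity_matrix d V E p" and ?L = "edge_list V E"
  let ?l = "length ?L"
  have R: "?R \<in> carrier_mat (d * card V) ?l" by (rule rigidity_matrix_carrier)
  then have RT: "?R\<^sup>T \<in> carrier_mat ?l (d * card V)" by simp
  define y where "y = ?R\<^sup>T *\<^sub>v x"
  have y: "y \<in> carrier_vec ?l" unfolding y_def using RT x by (rule mult_mat_vec_carrier)
  have "x \<bullet> (stiffness_matrix d V E p *\<^sub>v x) = x \<bullet> (?R *\<^sub>v y)"
    unfolding stiffness_matrix_def y_def using assoc_mult_mat_vec[OF R RT x] by simp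
  also have "\<dots> = y \<bullet> y" unfolding y_def
    using transpose_vec_mult_scalar[OF R y x] by (simp add: y_def)
  also have "\<dots> = (\<Sum>i<?l. (y $ i)\<^sup>2)"
    using y by (simp add: scalar_prod_def lessThan_atLeast0 power2_eq_square)
  also have "\<dots> = (\<Sum>i<?l. case ?L ! i of (u, v) \<Rightarrow> (edge_vec d V p u v \<bullet> x)\<^sup>2)"
  proof (rule sum.cong[OF refl])
    fix i assume "i \<in> {..<?l}"
    then have i: "i < ?l" by simp
    obtain u v where uv: "?L ! i = (u, v)" by (cases "?L ! i")
    then have "v \<in> V" using nth_mem[OF i] set_edge_list[OF fin, of E] by auto
    then have c: "edge_vec d V p u v \<in> carrier_vec (d * card V)" using p by (intro edge_vec_carrier) auto
    have "y $ i = col ?R i \<bullet> x" unfolding y_def using R i by simp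
    also have "col ?R i = edge_vec d V p u v"
      unfolding rigidity_matrix_def using i uv c by (subst col_mat_of_cols) auto
    finally show "(y $ i)\<^sup>2 = (case ?L ! i of (u, v) \<Rightarrow> (edge_vec d V p u v \<bullet> x)\<^sup>2)" by (simp add: uv)
  qed
  also have "\<dots> = (\<Sum>(u, v)\<leftarrow>?L. (edge_vec d V p u v \<bullet> x)\<^sup>2)"
    by (simp add: sum_list_sum_nth lessThan_atLeast0)
  finally show ?thesis .
qed

lemma edge_vec_scalar_prod:
  assumes p: "p v \<in> carrier_vec d" and uv: "u < n" "v < n" and x: "x \<in> carrier_vec (d * n)"
  shows "edge_vec d {..<n} p u v \<bullet> x
    = (\<Sum>a<d. direction d p u v $ a * (x $ (u * d + a) - x $ (v * d + a)))"
proof -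
  have vv: "vertex_vec {..<n} w = unit_vec n w" if "w < n" for w
  proof -
    have "{z \<in> {..<n}. z < w} = {..<w}" using that by auto
    then show ?thesis by (simp add: vertex_vec_def)
  qed
  have dd: "dim_vec (direction d p u v) = d" using p by (rule dim_direction)
  have idx: "edge_vec d {..<n} p u v $ (w * d + a)
     = ((if w = u then 1 else 0) - (if w = v then 1 else 0)) * direction d p u v $ a" if "w < n" "a < d" for w a
  proof -
    have "w * d + a < n * d" using block_index_less[OF that] by (simp add: mult.commute)
    then show ?thesis using that uv dd
      by (simp add: edge_vec_def kronecker_vec_def vv)
  qed
  have "edge_vec d {..<n} p u v \<bullet> x = (\<Sum>w<n. \<Sum>a<d. edge_vec d {..<n} p u v $ (w * d + a) * x $ (w * d + a))"
    using x by (intro scalar_prod_blocks) simp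
  also have "\<dots> = (\<Sum>w<n. (if w = u then \<Sum>a<d. direction d p u v $ a * x $ (u * d + a) else 0)
      - (if w = v then \<Sum>a<d. direction d p u v $ a * x $ (v * d + a) else 0))"
    using idx by (intro sum.cong refl) (auto simp: sum_negf)
  also have "\<dots> = (\<Sum>a<d. direction d p u v $ a * x $ (u * d + a)) - (\<Sum>a<d. direction d p u v $ a * x $ (v * d + a))"
    using uv by (simp add: sum_subtractf)
  finally show ?thesis by (simp add: sum_subtractf right_diff_distrib)
qed

lemma direction_entry_le_1:
  assumes p: "p v \<in> carrier_vec d" and a: "a < d"
  shows "\<bar>direction d p u v $ a\<bar> \<le> 1"
proof (cases "p u = p v")
  case False
  let ?w = "p u - p v"
  have w: "dim_vec ?w = d" using p by auto
  have "?w $ a * ?w $ a \<le> ?w \<bullet> ?w"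
    unfolding scalar_prod_def using a w by (intro member_le_sum) auto
  then have le: "\<bar>?w $ a\<bar> \<le> euclid_norm ?w"
    unfolding euclid_norm_def by (intro real_le_rsqrt) (simp add: power2_eq_square)
  have "\<bar>direction d p u v $ a\<bar> = \<bar>?w $ a\<bar> / \<bar>euclid_norm ?w\<bar>"
    using False a w p by (simp add: direction_def)
  also have "\<dots> \<le> 1" using le by (intro divide_le_eq_1[THEN iffD2]) linarith
  finally show ?thesis .
qed (use a in \<open>simp add: direction_def\<close>)

text \<open>A crude bound that is uniform in p: entries of a direction are at most 1 in absolute
  value, so each edge contributes at most (2 d |x|)^2.\<close>

lemma stiffness_form_le:
  assumes p: "p \<in> {..<n} \<rightarrow> carrier_vec d" and x: "x \<in> carrier_vec (d * n)"
  shows "x \<bullet> (stiffness_matrix d {..<n} E p *\<^sub>v x)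
    \<le> (real (length (edge_list {..<n} E)) * (2 * real d)\<^sup>2) * (x \<bullet> x)"
proof -
  let ?s = "sqrt (x \<bullet> x)"
  have xx: "x \<bullet> x \<ge> 0" by (simp add: scalar_prod_def sum_nonneg)
  have xi: "\<bar>x $ i\<bar> \<le> ?s" if "i < d * n" for i
  proof -
    have "x $ i * x $ i \<le> x \<bullet> x" unfolding scalar_prod_def
      using that x by (intro member_le_sum) auto
    then have "\<bar>x $ i\<bar>\<^sup>2 \<le> x \<bullet> x" by (simp add: power2_eq_square)
    then show ?thesis by (rule real_le_rsqrt)
  qed
  have bound: "(edge_vec d {..<n} p u v \<bullet> x)\<^sup>2 \<le> (2 * real d)\<^sup>2 * (x \<bullet> x)" if uv: "u < n" "v < n" for u v
  proof -
    have pv: "p v \<in> carrier_vec d" using p uv by auto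
    have "\<bar>edge_vec d {..<n} p u v \<bullet> x\<bar> \<le> (\<Sum>a<d. \<bar>direction d p u v $ a * (x $ (u * d + a) - x $ (v * d + a))\<bar>)"
      using edge_vec_scalar_prod[where p = p, OF pv uv x] by (simp add: sum_abs)
    also have "\<dots> \<le> (\<Sum>a<d. 2 * ?s)"
    proof (rule sum_mono)
      fix a assume "a \<in> {..<d}"
      then have a: "a < d" by simp
      have "\<bar>x $ (u * d + a) - x $ (v * d + a)\<bar> \<le> 2 * ?s"
        using xi[OF block_index_less[OF uv(1) a]] xi[OF block_index_less[OF uv(2) a]] by linarith
      then have "\<bar>direction d p u v $ a\<bar> * \<bar>x $ (u * d + a) - x $ (v * d + a)\<bar> \<le> 1 * (2 * ?s)"
        using direction_entry_le_1[where p = p, OF pv a, of u] by (intro mult_mono) simp_all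
      then show "\<bar>direction d p u v $ a * (x $ (u * d + a) - x $ (v * d + a))\<bar> \<le> 2 * ?s"
        by (simp add: abs_mult)
    qed
    also have "\<dots> = 2 * real d * ?s" by simp
    finally have "\<bar>edge_vec d {..<n} p u v \<bullet> x\<bar>\<^sup>2 \<le> (2 * real d * ?s)\<^sup>2" by (rule power_mono) simp
    then show ?thesis using xx by (simp add: power_mult_distrib)
  qed
  have "x \<bullet> (stiffness_matrix d {..<n} E p *\<^sub>v x) = (\<Sum>(u, v)\<leftarrow>edge_list {..<n} E. (edge_vec d {..<n} p u v \<bullet> x)\<^sup>2)"
    using p x by (intro stiffness_form) simp_all
  also have "\<dots> \<le> (\<Sum>_\<leftarrow>edge_list {..<n} E. (2 * real d)\<^sup>2 * (x \<bullet> x))"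
    using bound set_edge_list[of "{..<n}" E] by (intro sum_list_mono) auto
  also have "\<dots> = (real (length (edge_list {..<n} E)) * (2 * real d)\<^sup>2) * (x \<bullet> x)"
    by (simp add: sum_list_triv)
  finally show ?thesis .
qed

text \<open>Passes from vectors to plain functions: entry \<open>u * d + a\<close> is
  \<open>X u a\<close>. The functionals \<open>c k\<close> cut out the test space of the min-max
  bound, and as there are exactly (d + 1 choose 2) of them, the bounded eigenvalue is the one in the
  definition.\<close>

lemma algebraic_connectivity_ge:
  fixes c :: "'k \<Rightarrow> nat \<Rightarrow> nat \<Rightarrow> real"
  assumes p: "p \<in> {..<n} \<rightarrow> carrier_vec d"
    and K: "finite K" "card K = (d + 1 choose 2)" and r: "(d + 1 choose 2) < d * n"
    and form: "\<And>X. (\<forall>k\<in>K. (\<Sum>u<n. \<Sum>a<d. c k u a * X u a) = 0) \<Longrightarrow>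
      \<epsilon> * (\<Sum>u<n. \<Sum>a<d. (X u a)\<^sup>2)
        \<le> (\<Sum>(u, v)\<in>{(u, v). u < v \<and> v < n \<and> {u, v} \<in> E}. (\<Sum>a<d. direction d p u v $ a * (X u a - X v a))\<^sup>2)"
  shows "algebraic_connectivity d {..<n} E \<ge> \<epsilon>"
proof -
  let ?r = "d + 1 choose 2" and ?L = "stiffness_matrix d {..<n} E"
  have L: "?L p' \<in> carrier_mat (d * n) (d * n)" for p' using stiffness_matrix_carrier[of d "{..<n}"] by simp
  have "bdd_above ((\<lambda>p. ith_eigenvalue (?r + 1) (?L p)) ` ({..<n} \<rightarrow> carrier_vec d))"
    using ith_eigenvalue_le[OF L stiffness_matrix_symmetric r stiffness_form_le] by (intro bdd_aboveI2) blast
  then have "ith_eigenvalue (?r + 1) (?L p) \<le> algebraic_connectivity d {..<n} E"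
    unfolding algebraic_connectivity_def using p by (intro cSUP_upper)
  moreover have "\<epsilon> \<le> ith_eigenvalue (?r + 1) (?L p)"
  proof -
    obtain ks where ks: "set ks = K" "distinct ks" using finite_distinct_list[OF K(1)] by blast
    let ?v = "\<lambda>k. vec (d * n) (\<lambda>i. c k (i div d) (i mod d))"
    show ?thesis
    proof (rule ith_eigenvalue_ge[OF L stiffness_matrix_symmetric r, of "map ?v ks"])
      show "length (map ?v ks) = ?r" using ks K(2) distinct_card by force
      show "set (map ?v ks) \<subseteq> carrier_vec (d * n)" by auto
      fix x assume x: "x \<in> carrier_vec (d * n)" and orth: "\<forall>w\<in>set (map ?v ks). w \<bullet> x = 0"
      define X where "X u a = x $ (u * d + a)" for u a
      have "(\<Sum>u<n. \<Sum>a<d. c k u a * X u a) = 0" if "k \<in> K" for k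
      proof -
        have "(\<Sum>u<n. \<Sum>a<d. c k u a * X u a) = ?v k \<bullet> x"
          using x block_index_less[of _ n _ d] by (subst scalar_prod_blocks[of _ d n]) (auto simp: X_def intro!: sum.cong)
        also have "\<dots> = 0" using orth ks that by auto
        finally show ?thesis .
      qed
      then have "\<epsilon> * (\<Sum>u<n. \<Sum>a<d. (X u a)\<^sup>2)
        \<le> (\<Sum>(u, v)\<in>{(u, v). u < v \<and> v < n \<and> {u, v} \<in> E}. (\<Sum>a<d. direction d p u v $ a * (X u a - X v a))\<^sup>2)"
        using form[of X] by blast
      also have "\<dots> = (\<Sum>(u, v)\<in>set (edge_list {..<n} E). (edge_vec d {..<n} p u v \<bullet> x)\<^sup>2)"
      proof (rule sum.cong)
        show "{(u, v). u < v \<and> v < n \<and> {u, v} \<in> E} = set (edge_list {..<n} E)"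
          by (auto simp: set_edge_list)
        fix e assume "e \<in> set (edge_list {..<n} E)"
        then obtain u v where e: "e = (u, v)" "u < n" "v < n" by (auto simp: set_edge_list)
        then have "p v \<in> carrier_vec d" using p by auto
        from edge_vec_scalar_prod[where p = p, OF this e(2,3) x]
        show "(case e of (u, v) \<Rightarrow> (\<Sum>a<d. direction d p u v $ a * (X u a - X v a))\<^sup>2)
          = (case e of (u, v) \<Rightarrow> (edge_vec d {..<n} p u v \<bullet> x)\<^sup>2)" by (simp add: e X_def)
      qed
      also have "\<dots> \<le> (\<Sum>(u, v)\<leftarrow>edge_list {..<n} E. (edge_vec d {..<n} p u v \<bullet> x)\<^sup>2)"
        by (rule sum_set_le_sum_list) (simp split: prod.splits)
      also have "\<dots> = x \<bullet> (?L p *\<^sub>v x)" using p x by (intro stiffness_form[symmetric]) simp_all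
      also have "(\<Sum>u<n. \<Sum>a<d. (X u a)\<^sup>2) = x \<bullet> x"
        using x by (subst scalar_prod_blocks[of _ d n]) (simp_all add: X_def power2_eq_square)
      finally show "\<epsilon> * (x \<bullet> x) \<le> x \<bullet> (?L p *\<^sub>v x)" .
    qed
  qed
  ultimately show ?thesis by linarith
qed

text \<open>The coordinate of a displacement that an edge between the classes \<open>i\<close> and \<open>j\<close> sees.\<close>

definition pair_coord :: "nat \<Rightarrow> nat \<Rightarrow> (nat \<Rightarrow> real) \<Rightarrow> real" where
  "pair_coord i j Y = (if i = j then Y i else Y i - Y j)"

section \<open>Placement near the standard basis vectors\<close>

text \<open>Removes the square root and the case distinction: if p u = p v, both sides are 0 because
  division by 0 yields 0.\<close>

lemma direction_form:
  assumes p: "p v \<in> carrier_vec d"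
  shows "(\<Sum>a<d. direction d p u v $ a * z a)\<^sup>2
    = (\<Sum>a<d. (p u - p v) $ a * z a)\<^sup>2 / (\<Sum>a<d. ((p u - p v) $ a)\<^sup>2)"
proof -
  let ?w = "p u - p v"
  have w: "dim_vec ?w = d" using p by auto
  have ww: "?w \<bullet> ?w = (\<Sum>a<d. (?w $ a)\<^sup>2)" unfolding scalar_prod_def w
    by (simp add: power2_eq_square lessThan_atLeast0)
  have "direction d p u v $ a = ?w $ a / euclid_norm ?w" if "a < d" for a
    using that p w by (auto simp: direction_def)
  then have "(\<Sum>a<d. direction d p u v $ a * z a) = (\<Sum>a<d. ?w $ a * z a / euclid_norm ?w)"
    by (intro sum.cong) auto
  then show ?thesis
    by (simp add: euclid_norm_def ww power_divide sum_nonneg flip: sum_divide_distrib)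
qed

lemma square_ge_half_minus: "(x + y)\<^sup>2 \<ge> x\<^sup>2 / 2 - (y::real)\<^sup>2"
  using square_sum2_le[of "x + y" "- y"] by simp

text \<open>Inside a class the direction is exactly plus or minus a basis vector. Between classes it
  is proportional to A e_i - B e_j with A and B in [1, 2], and replacing A and B by 1 costs an error
  of order \<eta> n, measured through the bound S on the squared coordinates.\<close>

lemma perturbed_direction_form:
  fixes X :: "nat \<Rightarrow> nat \<Rightarrow> real" and \<eta> S :: real and d n :: nat and part :: "nat \<Rightarrow> nat"
  defines "p \<equiv> \<lambda>u. (1 + \<eta> * real u) \<cdot>\<^sub>v unit_vec d (part u)"
  assumes part: "part u < d" "part v < d" and uv: "u < v" "v < n"
    and \<eta>: "\<eta> > 0" "\<eta> * real n \<le> 1"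
    and S: "\<And>a. a < d \<Longrightarrow> (X u a)\<^sup>2 \<le> S" "\<And>a. a < d \<Longrightarrow> (X v a)\<^sup>2 \<le> S"
  shows "(pair_coord (part u) (part v) (X u) - pair_coord (part u) (part v) (X v))\<^sup>2 / 16 - 2 * (\<eta> * real n)\<^sup>2 * S
    \<le> (\<Sum>a<d. direction d p u v $ a * (X u a - X v a))\<^sup>2"
proof -
  let ?i = "part u" and ?j = "part v"
  define z where "z a = X u a - X v a" for a
  define A where "A = 1 + \<eta> * real u"
  define B where "B = 1 + \<eta> * real v"
  have S0: "S \<ge> 0" using S(1)[OF part(1)] zero_le_power2[of "X u ?i"] by linarith
  have sm: "\<eta> * real u \<le> \<eta> * real n" "\<eta> * real v \<le> \<eta> * real n" "\<eta> * real u \<ge> 0" "\<eta> * real v \<ge> 0"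
    using uv \<eta> by (simp_all add: mult_left_mono)
  have idx: "(p u - p v) $ a = (if a = ?i then A else 0) - (if a = ?j then B else 0)" if "a < d" for a
    using that part by (simp add: p_def A_def B_def)
  have s1: "(\<Sum>a<d. (p u - p v) $ a * z a) = A * z ?i - B * z ?j"
  proof -
    have "(\<Sum>a<d. (p u - p v) $ a * z a)
      = (\<Sum>a<d. (if a = ?i then A * z ?i else 0) - (if a = ?j then B * z ?j else 0))"
      using idx by (intro sum.cong) (auto simp: left_diff_distrib)
    then show ?thesis using part by (simp add: sum_subtractf)
  qed
  have s2: "(\<Sum>a<d. ((p u - p v) $ a)\<^sup>2) = (if ?i = ?j then (A - B)\<^sup>2 else A\<^sup>2 + B\<^sup>2)"
  proof (cases "?i = ?j")
    case True
    then have "(\<Sum>a<d. ((p u - p v) $ a)\<^sup>2) = (\<Sum>a<d. if a = ?i then (A - B)\<^sup>2 else 0)"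
      using idx by (intro sum.cong) auto
    then show ?thesis using part True by simp
  next
    case False
    then have "(\<Sum>a<d. ((p u - p v) $ a)\<^sup>2)
      = (\<Sum>a<d. (if a = ?i then A\<^sup>2 else 0) + (if a = ?j then B\<^sup>2 else 0))"
      using idx by (intro sum.cong) auto
    then show ?thesis using part False by (simp add: sum.distrib)
  qed
  have "p v \<in> carrier_vec d" by (simp add: p_def)
  note df = direction_form[where p = p, OF this, of u z, unfolded s1 s2]
  have err: "2 * (\<eta> * real n)\<^sup>2 * S \<ge> 0" using S0 by simp
  show ?thesis
  proof (cases "?i = ?j")
    case True
    have "A - B \<noteq> 0" using uv \<eta> by (simp add: A_def B_def)
    then have "(\<Sum>a<d. direction d p u v $ a * z a)\<^sup>2 = (z ?i)\<^sup>2"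
      unfolding df using True by (simp add: power_mult_distrib flip: left_diff_distrib)
    moreover have "(z ?i)\<^sup>2 / 16 \<le> (z ?i)\<^sup>2" by simp
    moreover have pc: "pair_coord ?i ?j (X u) - pair_coord ?i ?j (X v) = z ?i"
      using True by (simp add: pair_coord_def z_def)
    ultimately show ?thesis using err unfolding pc unfolding z_def by linarith
  next
    case False
    have AB: "0 < A" "A \<le> 2" "0 < B" "B \<le> 2" using sm \<eta> unfolding A_def B_def by linarith+
    have "A\<^sup>2 + B\<^sup>2 \<le> 8" using power_mono[of A 2 2] power_mono[of B 2 2] AB by simp
    moreover have "A\<^sup>2 + B\<^sup>2 > 0" using AB by (simp add: add_pos_pos)
    ultimately have ge: "(A * z ?i - B * z ?j)\<^sup>2 / 8 \<le> (A * z ?i - B * z ?j)\<^sup>2 / (A\<^sup>2 + B\<^sup>2)"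
      by (intro divide_left_mono) auto
    \<comment> \<open>\<open>e\<close> collects what A and B add to the ideal difference. By (x +
      e)^2 \<ge> x^2/2 - e^2 and division by 8 the main term gets 1/16 and, as e^2 \<le> 16 (\<eta>
      n)^2 S, the error gets the factor 2.\<close>
    define e where "e = \<eta> * real u * z ?i - \<eta> * real v * z ?j"
    have "A * z ?i - B * z ?j = (z ?i - z ?j) + e" by (simp add: A_def B_def e_def algebra_simps)
    then have h: "(A * z ?i - B * z ?j)\<^sup>2 \<ge> (z ?i - z ?j)\<^sup>2 / 2 - e\<^sup>2" using square_ge_half_minus by simp
    have z4: "(z a)\<^sup>2 \<le> 4 * S" if "a < d" for a
      using square_sum2_le[of "X u a" "- X v a"] S[OF that] by (simp add: z_def)
    have "e\<^sup>2 \<le> 2 * (\<eta> * real u * z ?i)\<^sup>2 + 2 * (\<eta> * real v * z ?j)\<^sup>2"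
      using square_sum2_le[of "\<eta> * real u * z ?i" "- (\<eta> * real v * z ?j)"] by (simp add: e_def)
    also have "(\<eta> * real u * z ?i)\<^sup>2 \<le> (\<eta> * real n)\<^sup>2 * (4 * S)"
      unfolding power_mult_distrib[of "\<eta> * real u"]
      by (rule mult_mono[OF power_mono[OF sm(1,3)] z4[OF part(1)]]) simp_all
    also have "(\<eta> * real v * z ?j)\<^sup>2 \<le> (\<eta> * real n)\<^sup>2 * (4 * S)"
      unfolding power_mult_distrib[of "\<eta> * real v"]
      by (rule mult_mono[OF power_mono[OF sm(2,4)] z4[OF part(2)]]) simp_all
    finally have "e\<^sup>2 \<le> 16 * (\<eta> * real n)\<^sup>2 * S" by (simp add: mult_ac)
    then have "(z ?i - z ?j)\<^sup>2 / 16 - 2 * (\<eta> * real n)\<^sup>2 * S \<le> (A * z ?i - B * z ?j)\<^sup>2 / 8"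
      using h by simp
    moreover have "pair_coord ?i ?j (X u) - pair_coord ?i ?j (X v) = z ?i - z ?j"
      using False by (simp add: pair_coord_def z_def)
    ultimately show ?thesis using ge df False unfolding z_def by simp
  qed
qed

text \<open>The main term is at least S / (16 C). There are at most n^2 edges with an error of 2
  (\<eta> n)^2 S each, and \<eta> is so small that together they consume at most half of it.\<close>

lemma algebraic_connectivity_ge_partition:
  fixes c :: "'k \<Rightarrow> nat \<Rightarrow> nat \<Rightarrow> real" and C :: real and part :: "nat \<Rightarrow> nat"
  assumes C: "C > 0" and part: "\<And>u. u < n \<Longrightarrow> part u < d"
    and K: "finite K" "card K = (d + 1 choose 2)" and r: "(d + 1 choose 2) < d * n"
    and core: "\<And>X. (\<forall>k\<in>K. (\<Sum>u<n. \<Sum>a<d. c k u a * X u a) = 0) \<Longrightarrow>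
      (\<Sum>u<n. \<Sum>a<d. (X u a)\<^sup>2) \<le> C * (\<Sum>(u, v)\<in>{(u, v). u < v \<and> v < n \<and> {u, v} \<in> E}.
          (pair_coord (part u) (part v) (X u) - pair_coord (part u) (part v) (X v))\<^sup>2)"
  shows "algebraic_connectivity d {..<n} E \<ge> 1 / (32 * C)"
proof -
  define N where "N = real n + 1"
  \<comment> \<open>The square of N compensates for labels up to n and for n^2 edges: 2 (\<eta>
    N^2)^2 = 1 / (32 (C + 1)^2) \<le> 1 / (32 C). Taking n + 1 for N avoids division by 0.\<close>
  define \<eta> where "\<eta> = 1 / (N\<^sup>2 * (8 * C + 8))"
  have N: "N \<ge> 1" "real n \<le> N" by (simp_all add: N_def)
  have \<eta>0: "\<eta> > 0" using C N by (simp add: \<eta>_def)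
  have \<eta>N: "\<eta> * N\<^sup>2 = 1 / (8 * C + 8)" using N by (simp add: \<eta>_def)
  have "\<eta> * real n \<le> \<eta> * N\<^sup>2"
    using \<eta>0 N by (intro mult_left_mono) (auto simp: power2_eq_square intro: order_trans[OF N(2)])
  also have "\<dots> \<le> 1" unfolding \<eta>N using C by simp
  finally have \<eta>1: "\<eta> * real n \<le> 1" .
  have small: "(real n)\<^sup>2 * (2 * (\<eta> * real n)\<^sup>2) \<le> 1 / (32 * C)"
  proof -
    have "(real n)\<^sup>2 * (2 * (\<eta> * real n)\<^sup>2) = 2 * (\<eta> * (real n)\<^sup>2)\<^sup>2" by (simp add: power2_eq_square)
    also have "\<dots> \<le> 2 * (\<eta> * N\<^sup>2)\<^sup>2"
      using \<eta>0 N by (intro mult_left_mono power_mono) auto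
    also have "\<dots> = 1 / (32 * (C + 1)\<^sup>2)"
      unfolding \<eta>N using power_mult_distrib[of 8 "C + 1" 2] by (simp add: power_divide)
    also have "\<dots> \<le> 1 / (32 * C)" using C by (intro frac_le) (auto simp: power2_eq_square algebra_simps)
    finally show ?thesis .
  qed
  define p where "p u = (1 + \<eta> * real u) \<cdot>\<^sub>v unit_vec d (part u)" for u :: nat
  have p: "p \<in> {..<n} \<rightarrow> carrier_vec d" by (simp add: p_def)
  show ?thesis
  proof (rule algebraic_connectivity_ge[OF p K r])
    fix X :: "nat \<Rightarrow> nat \<Rightarrow> real" assume con: "\<forall>k\<in>K. (\<Sum>u<n. \<Sum>a<d. c k u a * X u a) = 0"
    define S where "S = (\<Sum>u<n. \<Sum>a<d. (X u a)\<^sup>2)"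
    let ?P = "{(u, v). u < v \<and> v < n \<and> {u, v} \<in> E}"
    define q where "q u v = (pair_coord (part u) (part v) (X u) - pair_coord (part u) (part v) (X v))\<^sup>2" for u v
    have Xs: "(X u a)\<^sup>2 \<le> S" if "u < n" "a < d" for u a
    proof -
      have "(X u a)\<^sup>2 \<le> (\<Sum>a<d. (X u a)\<^sup>2)" using that by (intro member_le_sum) auto
      also have "\<dots> \<le> S" unfolding S_def using that
        by (intro member_le_sum[of u _ "\<lambda>u. \<Sum>a<d. (X u a)\<^sup>2"]) (auto intro: sum_nonneg)
      finally show ?thesis .
    qed
    have S0: "S \<ge> 0" unfolding S_def by (intro sum_nonneg) auto
    have sub: "?P \<subseteq> {..<n} \<times> {..<n}" by auto
    have "card ?P \<le> card ({..<n} \<times> {..<n})" by (rule card_mono[OF _ sub]) simp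
    then have cP: "real (card ?P) \<le> (real n)\<^sup>2" by (simp add: power2_eq_square flip: of_nat_mult)
    have "1 / (32 * C) * S = S / (16 * C) - 1 / (32 * C) * S" by simp
    moreover have "S / (16 * C) \<le> (\<Sum>(u, v)\<in>?P. q u v) / 16"
      using core[OF con] C unfolding S_def q_def by (simp add: field_simps)
    moreover have "real (card ?P) * (2 * (\<eta> * real n)\<^sup>2 * S) \<le> (real n)\<^sup>2 * (2 * (\<eta> * real n)\<^sup>2) * S"
      using mult_right_mono[OF cP, of "2 * (\<eta> * real n)\<^sup>2 * S"] S0 by (simp add: mult.assoc)
    moreover have "(real n)\<^sup>2 * (2 * (\<eta> * real n)\<^sup>2) * S \<le> 1 / (32 * C) * S"
      using small S0 by (rule mult_right_mono)
    ultimately have "1 / (32 * C) * S \<le> (\<Sum>(u, v)\<in>?P. q u v) / 16 - real (card ?P) * (2 * (\<eta> * real n)\<^sup>2 * S)"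
      by linarith
    also have "\<dots> = (\<Sum>(u, v)\<in>?P. q u v / 16 - 2 * (\<eta> * real n)\<^sup>2 * S)"
      by (simp add: case_prod_unfold sum_subtractf sum_divide_distrib)
    also have "\<dots> \<le> (\<Sum>(u, v)\<in>?P. (\<Sum>a<d. direction d p u v $ a * (X u a - X v a))\<^sup>2)"
    proof (rule sum_mono)
      fix e assume "e \<in> ?P"
      then obtain u v where e: "e = (u, v)" "u < v" "v < n" by auto
      have "q u v / 16 - 2 * (\<eta> * real n)\<^sup>2 * S \<le> (\<Sum>a<d. direction d p u v $ a * (X u a - X v a))\<^sup>2"
        unfolding q_def p_def
        using e \<eta>0 \<eta>1 by (intro perturbed_direction_form part Xs) auto
      then show "(case e of (u, v) \<Rightarrow> q u v / 16 - 2 * (\<eta> * real n)\<^sup>2 * S)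
        \<le> (case e of (u, v) \<Rightarrow> (\<Sum>a<d. direction d p u v $ a * (X u a - X v a))\<^sup>2)" by (simp add: e)
    qed
    finally show "1 / (32 * C) * (\<Sum>u<n. \<Sum>a<d. (X u a)\<^sup>2)
      \<le> (\<Sum>(u, v)\<in>?P. (\<Sum>a<d. direction d p u v $ a * (X u a - X v a))\<^sup>2)" unfolding S_def .
  qed
qed

section \<open>The layered graph\<close>

text \<open>The mean, here 0, minimises the squared deviation. This replaces the unspecified
  constant of a Poincare inequality by the vanishing of a mean, that is, of one of the
  functionals.\<close>

lemma sum_square_diff_ge:
  fixes g :: "'b \<Rightarrow> real"
  assumes "(\<Sum>x\<in>A. g x) = 0"
  shows "(\<Sum>x\<in>A. (g x)\<^sup>2) \<le> (\<Sum>x\<in>A. (g x - a)\<^sup>2)"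
proof -
  have "(\<Sum>x\<in>A. (g x - a)\<^sup>2) = (\<Sum>x\<in>A. (g x)\<^sup>2) - 2 * a * (\<Sum>x\<in>A. g x) + (\<Sum>x\<in>A. a\<^sup>2)"
    unfolding sum_distrib_left sum_subtractf[symmetric] sum.distrib[symmetric]
    by (intro sum.cong refl) (simp add: power2_eq_square algebra_simps)
  then show ?thesis using assms by (simp add: sum_nonneg)
qed

lemma abs_diff_le_steps:
  fixes b :: "nat \<Rightarrow> real"
  assumes "\<And>t. Suc t < M \<Longrightarrow> \<bar>b (Suc t) - b t\<bar> \<le> s" and "t < M"
  shows "\<bar>b t - b 0\<bar> \<le> real t * s"
  using assms(2)
proof (induction t)
  case (Suc t)
  then show ?case using assms(1)[of t] by (simp add: ring_distribs)
qed simp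

text \<open>Every fiber is compared with its value at \<open>\<kappa>0\<close>, and the resulting
  function on \<open>W\<close> obeys the inequality of the base. A base step from w to
  \<open>\<sigma> l w\<close> is replaced by three: along the fiber to the end of a link, across it,
  and along the other fiber to \<open>\<kappa>0\<close>; hence 3 (R + Q + R) = 6 R + 3 Q.\<close>

lemma fibered_poincare:
  fixes f :: "'w \<Rightarrow> 'c \<Rightarrow> real" and \<sigma> :: "nat \<Rightarrow> 'w \<Rightarrow> 'w" and e :: "'w \<Rightarrow> real"
  assumes C: "C \<ge> 0" and \<sigma>: "\<And>l w. w \<in> W \<Longrightarrow> \<sigma> l w \<in> W \<and> \<sigma> l (\<sigma> l w) = w"
    and poin: "\<And>\<psi>::'w \<Rightarrow> real. \<exists>a. (\<Sum>w\<in>W. (\<psi> w - a)\<^sup>2) \<le> C * (\<Sum>l<m. \<Sum>w\<in>W. (\<psi> (\<sigma> l w) - \<psi> w)\<^sup>2)"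
    and fib: "\<And>w \<kappa>. w \<in> W \<Longrightarrow> \<kappa> \<in> K \<Longrightarrow> (f w \<kappa> - f w \<kappa>0)\<^sup>2 \<le> e w"
    and R: "(\<Sum>w\<in>W. e w) \<le> R"
    and link: "\<And>l. l < m \<Longrightarrow> \<exists>\<kappa>\<in>K. \<exists>\<kappa>'\<in>K. (\<Sum>w\<in>W. (f w \<kappa> - f (\<sigma> l w) \<kappa>')\<^sup>2) \<le> Q"
  shows "\<exists>a. (\<Sum>w\<in>W. \<Sum>\<kappa>\<in>K. (f w \<kappa> - a)\<^sup>2) \<le> 2 * real (card K) * (R + C * (real m * (6 * R + 3 * Q)))"
proof -
  define g where "g w = f w \<kappa>0" for w
  have tri: "(x - y)\<^sup>2 \<le> 3 * ((x - u)\<^sup>2 + (u - v)\<^sup>2 + (v - y)\<^sup>2)" for x y u v :: real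
  proof -
    have "0 \<le> ((x - u) - (u - v))\<^sup>2 + ((u - v) - (v - y))\<^sup>2 + ((x - u) - (v - y))\<^sup>2" by simp
    then show ?thesis by (simp add: power2_eq_square algebra_simps)
  qed
  have "(\<Sum>w\<in>W. (g (\<sigma> l w) - g w)\<^sup>2) \<le> 6 * R + 3 * Q" if l: "l < m" for l
  proof -
    obtain \<kappa> \<kappa>' where k: "\<kappa> \<in> K" "\<kappa>' \<in> K" and q: "(\<Sum>w\<in>W. (f w \<kappa> - f (\<sigma> l w) \<kappa>')\<^sup>2) \<le> Q"
      using link[OF l] by blast
    have bij: "bij_betw (\<sigma> l) W W"
      using \<sigma> by (intro bij_betw_byWitness[where f' = "\<sigma> l"]) auto
    have "(\<Sum>w\<in>W. (g (\<sigma> l w) - g w)\<^sup>2) \<le> (\<Sum>w\<in>W. 3 * (e (\<sigma> l w) + (f w \<kappa> - f (\<sigma> l w) \<kappa>')\<^sup>2 + e w))"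
    proof (rule sum_mono)
      fix w assume w: "w \<in> W"
      show "(g (\<sigma> l w) - g w)\<^sup>2 \<le> 3 * (e (\<sigma> l w) + (f w \<kappa> - f (\<sigma> l w) \<kappa>')\<^sup>2 + e w)"
        using tri[of "g (\<sigma> l w)" "g w" "f (\<sigma> l w) \<kappa>'" "f w \<kappa>"] fib[OF w k(1)] fib[of "\<sigma> l w", OF _ k(2)] \<sigma>[OF w, of l]
        by (simp add: g_def power2_commute)
    qed
    also have "\<dots> = 3 * ((\<Sum>w\<in>W. e (\<sigma> l w)) + (\<Sum>w\<in>W. (f w \<kappa> - f (\<sigma> l w) \<kappa>')\<^sup>2) + (\<Sum>w\<in>W. e w))"
      by (simp add: sum.distrib flip: sum_distrib_left)
    also have "(\<Sum>w\<in>W. e (\<sigma> l w)) = (\<Sum>w\<in>W. e w)" by (rule sum.reindex_bij_betw[OF bij])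
    also have "3 * ((\<Sum>w\<in>W. e w) + (\<Sum>w\<in>W. (f w \<kappa> - f (\<sigma> l w) \<kappa>')\<^sup>2) + (\<Sum>w\<in>W. e w)) \<le> 3 * (R + Q + R)"
      using R q by (intro mult_left_mono add_mono) auto
    finally show ?thesis by simp
  qed
  then have "(\<Sum>l<m. \<Sum>w\<in>W. (g (\<sigma> l w) - g w)\<^sup>2) \<le> (\<Sum>l<m. 6 * R + 3 * Q)" by (intro sum_mono) simp
  then have en: "(\<Sum>l<m. \<Sum>w\<in>W. (g (\<sigma> l w) - g w)\<^sup>2) \<le> real m * (6 * R + 3 * Q)" by simp
  obtain a where "(\<Sum>w\<in>W. (g w - a)\<^sup>2) \<le> C * (\<Sum>l<m. \<Sum>w\<in>W. (g (\<sigma> l w) - g w)\<^sup>2)"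
    using poin by blast
  also have "\<dots> \<le> C * (real m * (6 * R + 3 * Q))" using en C by (rule mult_left_mono)
  finally have a: "(\<Sum>w\<in>W. (g w - a)\<^sup>2) \<le> C * (real m * (6 * R + 3 * Q))" .
  have "(\<Sum>w\<in>W. \<Sum>\<kappa>\<in>K. (f w \<kappa> - a)\<^sup>2) \<le> (\<Sum>w\<in>W. \<Sum>\<kappa>\<in>K. 2 * e w + 2 * (g w - a)\<^sup>2)"
  proof (intro sum_mono)
    fix w \<kappa> assume "w \<in> W" "\<kappa> \<in> K"
    from fib[OF this] show "(f w \<kappa> - a)\<^sup>2 \<le> 2 * e w + 2 * (g w - a)\<^sup>2"
      using square_diff_via[of "f w \<kappa>" a "g w"] by (simp add: g_def)
  qed
  also have "\<dots> = (\<Sum>w\<in>W. 2 * real (card K) * (e w + (g w - a)\<^sup>2))"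
    by (intro sum.cong refl) (simp add: algebra_simps)
  also have "\<dots> = 2 * real (card K) * ((\<Sum>w\<in>W. e w) + (\<Sum>w\<in>W. (g w - a)\<^sup>2))"
    by (simp add: sum.distrib flip: sum_distrib_left)
  also have "\<dots> \<le> 2 * real (card K) * (R + C * (real m * (6 * R + 3 * Q)))"
    using a R by (intro mult_left_mono) auto
  finally show ?thesis by blast
qed

text \<open>The connection set of a circulant graph on M residues, closed under negation. For odd D
  one step must be its own negative, which is why M will be even.\<close>

definition circulant_steps :: "nat \<Rightarrow> nat \<Rightarrow> nat set" where
  "circulant_steps M D = {1..D div 2} \<union> {M - D div 2..<M} \<union> (if odd D then {M div 2} else {})"

text \<open>The size of \<open>q\<close> leaves room for five links in each block of positions and
  keeps the D circulant steps distinct; its parity makes M even. D is the degree along the fiber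
  inside a class, at least 2 for a cycle.\<close>

locale layered_graph =
  fixes d q D :: nat and W :: "'w set" and \<sigma> :: "nat \<Rightarrow> 'w \<Rightarrow> 'w"
  assumes d: "d \<ge> 1" and D: "D \<ge> 2" and q: "q > D + 4" "even q"
    and finW: "finite W"
    and \<sigma>: "\<And>l w. w \<in> W \<Longrightarrow> \<sigma> l w \<in> W"
    and \<sigma>\<sigma>: "\<And>l w. w \<in> W \<Longrightarrow> \<sigma> l (\<sigma> l w) = w"
    and \<sigma>_ne: "\<And>l w. w \<in> W \<Longrightarrow> \<sigma> l w \<noteq> w"
begin

definition M :: nat where "M = q * d"

definition vertices :: "(nat \<times> 'w \<times> nat) set" where
  "vertices = {..<d} \<times> W \<times> {..<M}"

text \<open>In \<open>(i, w, t)\<close>, \<open>i\<close> is the class, \<open>w\<close> a point of the base expander, and \<open>t\<close> a position in the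
  fiber over \<open>w\<close>. Position \<open>j * q + l\<close> carries the extra edge of the graph between classes \<open>i\<close> and
  \<open>j\<close>, along the \<open>l\<close>-th involution.\<close>

fun link :: "nat \<times> 'w \<times> nat \<Rightarrow> nat \<times> 'w \<times> nat" where
  "link (i, w, t) = (t div q, \<sigma> (t mod q) w, i * q + t mod q)"

text \<open>Over a fixed w and for i < j, the edges from t to t and from t to t + 1 form one cycle
  of length 2 M through both fibers; \<open>t + (M - 1)\<close> is t - 1 modulo M, the same edge
  seen from the larger class. The circulant step 1 gives a cycle inside a class.\<close>

fun nbrs :: "nat \<times> 'w \<times> nat \<Rightarrow> (nat \<times> 'w \<times> nat) set" where
  "nbrs (i, w, t) =
     (\<lambda>s. (i, w, (t + s) mod M)) ` circulant_steps M D
     \<union> (\<lambda>j. (j, w, t)) ` ({..<d} - {i})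
     \<union> (\<lambda>j. (j, w, (if i < j then t + 1 else t + (M - 1)) mod M)) ` ({..<d} - {i})
     \<union> {link (i, w, t)}"

definition disc :: "(nat \<times> 'w \<times> nat \<Rightarrow> nat \<Rightarrow> real) \<Rightarrow> nat \<times> 'w \<times> nat \<Rightarrow> nat \<times> 'w \<times> nat \<Rightarrow> real" where
  "disc Y x y = (pair_coord (fst x) (fst y) (Y x) - pair_coord (fst x) (fst y) (Y y))\<^sup>2"

lemma M_bounds: "M > D + 4" "M > 0" "even M"
proof -
  have "q * 1 \<le> M" unfolding M_def using d by (intro mult_le_mono2)
  then show "M > D + 4" "M > 0" using q by simp_all
  show "even M" using q by (simp add: M_def)
qed

lemma circulant_steps_range:
  assumes "s \<in> circulant_steps M D"
  shows "0 < s" "s < M"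
  using assms M_bounds D by (auto simp: circulant_steps_def split: if_splits)

lemma one_circulant_step: "1 \<in> circulant_steps M D"
  using D by (auto simp: circulant_steps_def)

lemma nbrs_step: "s \<in> circulant_steps M D \<Longrightarrow> (i, w, (t + s) mod M) \<in> nbrs (i, w, t)"
  unfolding nbrs.simps by blast

lemma nbrs_cross: "j < d \<Longrightarrow> j \<noteq> i \<Longrightarrow> (j, w, t) \<in> nbrs (i, w, t)"
  unfolding nbrs.simps by blast

lemma nbrs_cross_shift: "j < d \<Longrightarrow> i < j \<Longrightarrow> (j, w, (t + 1) mod M) \<in> nbrs (i, w, t)"
  unfolding nbrs.simps by (rule UnI1, rule UnI2, rule image_eqI[of _ _ j]) auto

lemma nbrs_cross_unshift: "i < d \<Longrightarrow> i < j \<Longrightarrow> (i, w, (t + (M - 1)) mod M) \<in> nbrs (j, w, t)"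
  unfolding nbrs.simps by (rule UnI1, rule UnI2, rule image_eqI[of _ _ i]) auto

lemma nbrs_link: "link x \<in> nbrs x"
  by (cases x) simp

text \<open>Hypothesis \<open>Q\<close> bounds one edge family at a time, with one edge for each
  point of \<open>W\<close>. Finitely many such families, their number depending on M only, connect
  the fibers \<open>{i, j} \<times> {..<M}\<close> and link them along the five involutions, so
  \<open>fibered_poincare\<close> applies.\<close>

lemma pair_poincare:
  fixes Y :: "nat \<times> 'w \<times> nat \<Rightarrow> nat \<Rightarrow> real"
  assumes C: "C \<ge> 0"
    and poin: "\<And>\<psi>::'w \<Rightarrow> real. \<exists>a. (\<Sum>w\<in>W. (\<psi> w - a)\<^sup>2) \<le> C * (\<Sum>l<5. \<Sum>w\<in>W. (\<psi> (\<sigma> l w) - \<psi> w)\<^sup>2)"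
    and Q: "\<And>x y. inj_on x W \<Longrightarrow> (\<And>w. w \<in> W \<Longrightarrow> x w \<in> vertices \<and> y w \<in> nbrs (x w)) \<Longrightarrow>
        (\<Sum>w\<in>W. disc Y (x w) (y w)) \<le> Q"
    and ij: "i \<le> j" "j < d"
  shows "\<exists>a. (\<Sum>w\<in>W. \<Sum>(l, t)\<in>{i, j} \<times> {..<M}. (pair_coord i j (Y (l, w, t)) - a)\<^sup>2)
    \<le> (4 * real M * (8 * real M ^ 3 + C * (5 * (48 * real M ^ 3 + 3)))) * Q"
proof -
  have Q0: "Q \<ge> 0"
  proof -
    have "(\<Sum>w\<in>W. disc Y (i, w, 0) (link (i, w, 0))) \<le> Q"
      using ij M_bounds nbrs_link by (intro Q) (auto simp: inj_on_def vertices_def simp del: nbrs.simps link.simps)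
    moreover have "(\<Sum>w\<in>W. disc Y (i, w, 0) (link (i, w, 0))) \<ge> 0" by (intro sum_nonneg) (simp add: disc_def)
    ultimately show ?thesis by linarith
  qed
  define f where "f w \<kappa> = pair_coord i j (Y (fst \<kappa>, w, snd \<kappa>))" for w and \<kappa> :: "nat \<times> nat"
  let ?K = "{i, j} \<times> {..<M}"
  \<comment> \<open>\<open>E w\<close> is the energy of the cycle in the fiber over w. A path of at
    most 2 M edges, each bounded by sqrt (E w), gives the factor 4 M^2; for i = j the bounds are
    relaxed to the same constants.\<close>
  have "\<exists>E. (\<Sum>w\<in>W. E w) \<le> 2 * real M * Q \<and> (\<forall>w\<in>W. \<forall>\<kappa>\<in>?K. (f w \<kappa> - f w (i, 0))\<^sup>2 \<le> 4 * (real M)\<^sup>2 * E w)"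
  proof (cases "i = j")
    case True
    define E where "E w = (\<Sum>t<M. (f w (i, t) - f w (i, (t + 1) mod M))\<^sup>2)" for w
    have "(\<Sum>w\<in>W. (f w (i, t) - f w (i, (t + 1) mod M))\<^sup>2) \<le> Q" if t: "t < M" for t
    proof -
      have "(\<Sum>w\<in>W. disc Y (i, w, t) (i, w, (t + 1) mod M)) \<le> Q"
        using ij t nbrs_step[OF one_circulant_step] by (intro Q) (auto simp: inj_on_def vertices_def simp del: nbrs.simps)
      then show ?thesis by (simp add: disc_def f_def True)
    qed
    then have "(\<Sum>t<M. \<Sum>w\<in>W. (f w (i, t) - f w (i, (t + 1) mod M))\<^sup>2) \<le> (\<Sum>t<M. Q)"
      by (intro sum_mono) simp
    then have "(\<Sum>w\<in>W. E w) \<le> real M * Q" unfolding E_def by (subst sum.swap) simp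
    also have "\<dots> \<le> 2 * real M * Q" using Q0 by (intro mult_right_mono) auto
    finally have "(\<Sum>w\<in>W. E w) \<le> 2 * real M * Q" .
    moreover have "(f w \<kappa> - f w (i, 0))\<^sup>2 \<le> 4 * (real M)\<^sup>2 * E w" if "w \<in> W" "\<kappa> \<in> ?K" for w \<kappa>
    proof -
      obtain t where t: "\<kappa> = (i, t)" "t < M" using \<open>\<kappa> \<in> ?K\<close> True by auto
      have E0: "E w \<ge> 0" unfolding E_def by (intro sum_nonneg) simp
      have step: "\<bar>f w (i, Suc t) - f w (i, t)\<bar> \<le> sqrt (E w)" if "Suc t < M" for t
      proof (rule real_le_rsqrt)
        have "(f w (i, t) - f w (i, (t + 1) mod M))\<^sup>2 \<le> E w"
          unfolding E_def using that by (intro member_le_sum[of t _ "\<lambda>t. (f w (i, t) - f w (i, (t + 1) mod M))\<^sup>2"]) auto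
        then show "\<bar>f w (i, Suc t) - f w (i, t)\<bar>\<^sup>2 \<le> E w" using that by (simp add: power2_commute)
      qed
      have "\<bar>f w (i, t) - f w (i, 0)\<bar> \<le> real t * sqrt (E w)"
        using step t(2) by (rule abs_diff_le_steps[of M "\<lambda>t. f w (i, t)"])
      also have "\<dots> \<le> 2 * real M * sqrt (E w)" using t E0 by (intro mult_right_mono) auto
      finally have "\<bar>f w (i, t) - f w (i, 0)\<bar>\<^sup>2 \<le> (2 * real M * sqrt (E w))\<^sup>2" by (rule power_mono) simp
      then show ?thesis using E0 by (simp add: t power_mult_distrib)
    qed
    ultimately show ?thesis by blast
  next
    case False
    then have lt: "i < j" using ij by simp
    define E where "E w = (\<Sum>t<M. (f w (i, t) - f w (j, t))\<^sup>2 + (f w (i, t) - f w (j, (t + 1) mod M))\<^sup>2)" for w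
    have "(\<Sum>w\<in>W. (f w (i, t) - f w (j, t))\<^sup>2 + (f w (i, t) - f w (j, (t + 1) mod M))\<^sup>2) \<le> 2 * Q" if t: "t < M" for t
    proof -
      have "(\<Sum>w\<in>W. disc Y (i, w, t) (j, w, t)) \<le> Q"
        using ij t lt nbrs_cross by (intro Q) (auto simp: inj_on_def vertices_def simp del: nbrs.simps)
      moreover have "(\<Sum>w\<in>W. disc Y (i, w, t) (j, w, (t + 1) mod M)) \<le> Q"
        using ij t lt nbrs_cross_shift by (intro Q) (auto simp: inj_on_def vertices_def simp del: nbrs.simps)
      ultimately show ?thesis by (simp add: disc_def f_def sum.distrib)
    qed
    then have "(\<Sum>t<M. \<Sum>w\<in>W. (f w (i, t) - f w (j, t))\<^sup>2 + (f w (i, t) - f w (j, (t + 1) mod M))\<^sup>2) \<le> (\<Sum>t<M. 2 * Q)"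
      by (intro sum_mono) simp
    then have "(\<Sum>w\<in>W. E w) \<le> 2 * real M * Q" unfolding E_def by (subst sum.swap) simp
    moreover have "(f w \<kappa> - f w (i, 0))\<^sup>2 \<le> 4 * (real M)\<^sup>2 * E w" if "w \<in> W" and \<kappa>: "\<kappa> \<in> ?K" for w \<kappa>
    proof -
      have E0: "E w \<ge> 0" unfolding E_def by (intro sum_nonneg) simp
      have le: "(f w (i, t) - f w (j, t))\<^sup>2 + (f w (i, t) - f w (j, (t + 1) mod M))\<^sup>2 \<le> E w" if "t < M" for t
        unfolding E_def using that
        by (intro member_le_sum[of t _ "\<lambda>t. (f w (i, t) - f w (j, t))\<^sup>2 + (f w (i, t) - f w (j, (t + 1) mod M))\<^sup>2"]) auto
      have s1: "\<bar>f w (i, t) - f w (j, t)\<bar> \<le> sqrt (E w)" if "t < M" for t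
      proof -
        have "(f w (i, t) - f w (j, t))\<^sup>2 \<le> E w"
          using le[OF that] zero_le_power2[of "f w (i, t) - f w (j, (t + 1) mod M)"] by linarith
        then show ?thesis by (intro real_le_rsqrt) simp
      qed
      have s2: "\<bar>f w (i, t) - f w (j, (t + 1) mod M)\<bar> \<le> sqrt (E w)" if "t < M" for t
      proof -
        have "(f w (i, t) - f w (j, (t + 1) mod M))\<^sup>2 \<le> E w"
          using le[OF that] zero_le_power2[of "f w (i, t) - f w (j, t)"] by linarith
        then show ?thesis by (intro real_le_rsqrt) simp
      qed
      \<comment> \<open>The path from (i, t) to (i, t + 1) runs through (j, t + 1).\<close>
      have step: "\<bar>f w (i, Suc t) - f w (i, t)\<bar> \<le> 2 * sqrt (E w)" if "Suc t < M" for t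
        using s1[OF that] s2[of t] that by simp
      have walk: "\<bar>f w (i, t) - f w (i, 0)\<bar> \<le> real t * (2 * sqrt (E w))" if "t < M" for t
        using step that by (rule abs_diff_le_steps[of M "\<lambda>t. f w (i, t)"])
      obtain t where t: "\<kappa> = (i, t) \<or> \<kappa> = (j, t)" "t < M" using \<kappa> by auto
      have "\<bar>f w \<kappa> - f w (i, 0)\<bar> \<le> real t * (2 * sqrt (E w)) + sqrt (E w)"
        using t(1) walk[OF t(2)] s1[OF t(2)] E0 real_sqrt_ge_zero[OF E0] by fastforce
      also have "\<dots> = (2 * real t + 1) * sqrt (E w)" by (simp add: algebra_simps)
      also have "\<dots> \<le> 2 * real M * sqrt (E w)" using t E0 by (intro mult_right_mono) auto
      finally have "\<bar>f w \<kappa> - f w (i, 0)\<bar>\<^sup>2 \<le> (2 * real M * sqrt (E w))\<^sup>2" by (rule power_mono) simp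
      then show ?thesis using E0 by (simp add: power_mult_distrib)
    qed
    ultimately show ?thesis by blast
  qed
  then obtain E where E: "(\<Sum>w\<in>W. E w) \<le> 2 * real M * Q"
    and fib: "\<And>w \<kappa>. w \<in> W \<Longrightarrow> \<kappa> \<in> ?K \<Longrightarrow> (f w \<kappa> - f w (i, 0))\<^sup>2 \<le> 4 * (real M)\<^sup>2 * E w" by blast
  \<comment> \<open>The product of 4 M^2 and 2 M Q; it is the source of 8 and of 48 = 6 * 8 in the
    final constant.\<close>
  define R where "R = 8 * real M ^ 3 * Q"
  have R: "(\<Sum>w\<in>W. 4 * (real M)\<^sup>2 * E w) \<le> R"
  proof -
    have "(\<Sum>w\<in>W. 4 * (real M)\<^sup>2 * E w) = 4 * (real M)\<^sup>2 * (\<Sum>w\<in>W. E w)" by (simp add: sum_distrib_left)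
    also have "\<dots> \<le> 4 * (real M)\<^sup>2 * (2 * real M * Q)" using E by (rule mult_left_mono) simp
    also have "\<dots> = R" by (simp add: R_def power3_eq_cube power2_eq_square)
    finally show ?thesis .
  qed
  have lk: "\<exists>\<kappa>\<in>?K. \<exists>\<kappa>'\<in>?K. (\<Sum>w\<in>W. (f w \<kappa> - f (\<sigma> l w) \<kappa>')\<^sup>2) \<le> Q" if l: "l < 5" for l
  proof -
    have lq: "l < q" using l q D by simp
    have tM: "a * q + l < M" if "a < d" for a
    proof -
      have "a * q + l < Suc a * q" using lq by simp
      also have "\<dots> \<le> d * q" using that by (intro mult_le_mono1) simp
      finally show ?thesis by (simp add: M_def mult.commute)
    qed
    have lnk: "link (i, w, j * q + l) = (j, \<sigma> l w, i * q + l)" for w using lq by simp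
    have "(\<Sum>w\<in>W. disc Y (i, w, j * q + l) (j, \<sigma> l w, i * q + l)) \<le> Q"
      using ij tM[of j] nbrs_link[of "(i, _, j * q + l)"] unfolding lnk
      by (intro Q) (auto simp: inj_on_def vertices_def simp del: link.simps nbrs.simps)
    then have "(\<Sum>w\<in>W. (f w (i, j * q + l) - f (\<sigma> l w) (j, i * q + l))\<^sup>2) \<le> Q"
      by (simp add: disc_def f_def)
    then show ?thesis using tM[of i] tM[of j] ij by (intro bexI[of _ "(i, j * q + l)"] bexI[of _ "(j, i * q + l)"]) auto
  qed
  have "\<exists>a. (\<Sum>w\<in>W. \<Sum>\<kappa>\<in>?K. (f w \<kappa> - a)\<^sup>2) \<le> 2 * real (card ?K) * (R + C * (real 5 * (6 * R + 3 * Q)))"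
    by (rule fibered_poincare[OF C _ poin fib R lk]) (auto simp: \<sigma> \<sigma>\<sigma>)
  then obtain a where "(\<Sum>w\<in>W. \<Sum>\<kappa>\<in>?K. (f w \<kappa> - a)\<^sup>2) \<le> 2 * real (card ?K) * (R + C * (5 * (6 * R + 3 * Q)))"
    by auto
  also have "\<dots> \<le> 2 * (2 * real M) * (R + C * (5 * (6 * R + 3 * Q)))"
  proof (rule mult_right_mono)
    have "card ?K \<le> 2 * M" by (simp add: card_cartesian_product card_insert_if)
    then show "2 * real (card ?K) \<le> 2 * (2 * real M)" by linarith
    show "0 \<le> R + C * (5 * (6 * R + 3 * Q))" using C Q0 by (simp add: R_def)
  qed
  also have "\<dots> = (4 * real M * (8 * real M ^ 3 + C * (5 * (48 * real M ^ 3 + 3)))) * Q"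
    by (simp add: R_def algebra_simps)
  finally show ?thesis by (intro exI[of _ a]) (simp add: f_def case_prod_unfold)
qed

end

section \<open>Numbering the vertices by natural numbers\<close>

text \<open>Vertices have to be linearly ordered for \<open>algebraic_connectivity\<close>, and the
  theorem asks for sets of naturals; an arbitrary bijection provides both.\<close>

definition relabelled_edges :: "nat \<Rightarrow> (nat \<Rightarrow> 'v) \<Rightarrow> ('v \<Rightarrow> 'v set) \<Rightarrow> nat set set" where
  "relabelled_edges n \<phi> N = {{u, v} |u v. u < n \<and> v < n \<and> \<phi> v \<in> N (\<phi> u)}"

locale relabelling =
  fixes n :: nat and \<phi> :: "nat \<Rightarrow> 'v" and S :: "'v set" and N :: "'v \<Rightarrow> 'v set"
  assumes bij: "bij_betw \<phi> {..<n} S"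
    and sub: "\<And>x. x \<in> S \<Longrightarrow> N x \<subseteq> S"
    and irr: "\<And>x. x \<in> S \<Longrightarrow> x \<notin> N x"
    and sym: "\<And>x y. x \<in> S \<Longrightarrow> y \<in> N x \<Longrightarrow> x \<in> N y"
begin

abbreviation "E \<equiv> relabelled_edges n \<phi> N"

lemma in_S: "u < n \<Longrightarrow> \<phi> u \<in> S"
  using bij by (auto simp: bij_betw_def)

lemma inj: "u < n \<Longrightarrow> v < n \<Longrightarrow> \<phi> u = \<phi> v \<Longrightarrow> u = v"
  using bij by (auto simp: bij_betw_def inj_on_def)

lemma edge_iff:
  assumes "u < n" "v < n"
  shows "{u, v} \<in> E \<longleftrightarrow> \<phi> v \<in> N (\<phi> u)"
  using assms in_S sym unfolding relabelled_edges_def by (auto simp: doubleton_eq_iff)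

lemma simple: "finite_simple_graph {..<n} E"
proof -
  have "e \<subseteq> {..<n} \<and> card e = 2" if e: "e \<in> E" for e
  proof -
    obtain u v where uv: "e = {u, v}" "u < n" "v < n" "\<phi> v \<in> N (\<phi> u)"
      using e by (auto simp: relabelled_edges_def)
    then have "u \<noteq> v" using irr in_S by blast
    then show ?thesis using uv by auto
  qed
  then show ?thesis by (simp add: finite_simple_graph_def)
qed

lemma regular:
  assumes "\<And>x. x \<in> S \<Longrightarrow> card (N x) = k"
  shows "regular_graph k {..<n} E"
  unfolding regular_graph_def
proof
  fix u assume "u \<in> {..<n}"
  then have u: "u < n" by simp
  define B where "B = {v. v < n \<and> \<phi> v \<in> N (\<phi> u)}"
  have "{e \<in> E. u \<in> e} = (\<lambda>v. {u, v}) ` B"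
  proof (intro equalityI subsetI)
    fix e assume e: "e \<in> {e \<in> E. u \<in> e}"
    then obtain a b where ab: "e = {a, b}" "a < n" "b < n" by (auto simp: relabelled_edges_def)
    then obtain v where v: "e = {u, v}" "v < n" using e by (auto simp: insert_commute)
    then show "e \<in> (\<lambda>v. {u, v}) ` B" using e edge_iff[OF u v(2)] by (auto simp: B_def)
  qed (use edge_iff[OF u] in \<open>auto simp: B_def\<close>)
  moreover have "inj_on (\<lambda>v. {u, v}) B" by (auto simp: inj_on_def doubleton_eq_iff)
  ultimately have "card {e \<in> E. u \<in> e} = card B" by (simp add: card_image)
  also have "bij_betw \<phi> B (N (\<phi> u))"
    unfolding bij_betw_def
  proof
    show "inj_on \<phi> B" using inj by (auto simp: inj_on_def B_def)
    show "\<phi> ` B = N (\<phi> u)"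
    proof (intro equalityI subsetI)
      fix y assume y: "y \<in> N (\<phi> u)"
      then have "y \<in> \<phi> ` {..<n}" using sub[OF in_S[OF u]] bij by (auto simp: bij_betw_def)
      then show "y \<in> \<phi> ` B" using y by (auto simp: B_def)
    qed (auto simp: B_def)
  qed
  then have "card B = k" using bij_betw_same_card assms in_S[OF u] by metis
  finally show "card {e \<in> E. u \<in> e} = k" .
qed

text \<open>Injectivity of x makes the oriented pairs (x w, y w) distinct, so each edge is hit at
  most once in either orientation; hence the factor 2.\<close>

lemma energy_ge:
  fixes T :: "'v \<Rightarrow> 'v \<Rightarrow> real"
  assumes T: "\<And>x y. T x y \<ge> 0" "\<And>x y. T x y = T y x" and fin: "finite A"
    and h: "inj_on x A" "\<And>w. w \<in> A \<Longrightarrow> x w \<in> S \<and> y w \<in> N (x w)"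
  shows "(\<Sum>w\<in>A. T (x w) (y w)) \<le> 2 * (\<Sum>(u, v)\<in>{(u, v). u < v \<and> v < n \<and> {u, v} \<in> E}. T (\<phi> u) (\<phi> v))"
proof -
  let ?P = "{(u, v). u < v \<and> v < n \<and> {u, v} \<in> E}"
  let ?P' = "{(u, v). v < u \<and> u < n \<and> {u, v} \<in> E}"
  let ?T = "\<lambda>(u, v). T (\<phi> u) (\<phi> v)"
  define \<psi> where "\<psi> = inv_into {..<n} \<phi>"
  have \<psi>: "\<psi> z < n" "\<phi> (\<psi> z) = z" if "z \<in> S" for z
    using that bij inv_into_into[of z \<phi> "{..<n}"] f_inv_into_f[of z \<phi> "{..<n}"]
    by (auto simp: \<psi>_def bij_betw_def)
  have xy: "x w \<in> S" "y w \<in> S" "y w \<in> N (x w)" if "w \<in> A" for w using h(2)[OF that] sub by auto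
  have finP: "finite ?P" by (rule finite_subset[of _ "{..<n} \<times> {..<n}"]) auto
  have finP': "finite ?P'" by (rule finite_subset[of _ "{..<n} \<times> {..<n}"]) auto
  define g where "g w = (\<psi> (x w), \<psi> (y w))" for w
  have inj_g: "inj_on g A"
  proof (rule inj_onI)
    fix a b assume ab: "a \<in> A" "b \<in> A" "g a = g b"
    then have "\<phi> (\<psi> (x a)) = \<phi> (\<psi> (x b))" by (simp add: g_def)
    then show "a = b" using \<psi>(2) xy(1) ab h(1) by (auto dest: inj_onD)
  qed
  have "(\<Sum>w\<in>A. T (x w) (y w)) = sum ?T (g ` A)"
    unfolding sum.reindex[OF inj_g] using \<psi>(2) xy by (intro sum.cong) (auto simp: g_def)
  also have "\<dots> \<le> sum ?T (?P \<union> ?P')"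
  proof (rule sum_mono2)
    show "g ` A \<subseteq> ?P \<union> ?P'"
    proof
      fix e assume "e \<in> g ` A"
      then obtain w where w: "w \<in> A" "e = g w" by auto
      have ne: "\<psi> (x w) \<noteq> \<psi> (y w)" using \<psi>(2) xy[OF w(1)] irr by metis
      have "{\<psi> (x w), \<psi> (y w)} \<in> E" using edge_iff \<psi> xy[OF w(1)] by simp
      then show "e \<in> ?P \<union> ?P'" using ne \<psi>(1) xy[OF w(1)] w by (auto simp: g_def)
    qed
  qed (use finP finP' T in auto)
  also have "\<dots> = sum ?T ?P + sum ?T ?P'"
    using finP finP' by (intro sum.union_disjoint) auto
  also have "sum ?T ?P' = sum ?T ?P"
    by (rule sum.reindex_bij_witness[where i = prod.swap and j = prod.swap])
       (auto simp: insert_commute T(2))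
  finally show ?thesis by simp
qed

end

section \<open>Symmetry and regularity of the neighbourhoods\<close>

context layered_graph
begin

lemma circulant_steps_minus:
  assumes "s \<in> circulant_steps M D"
  shows "M - s \<in> circulant_steps M D"
  using assms M_bounds by (auto simp: circulant_steps_def split: if_splits)

lemma card_circulant_steps: "card (circulant_steps M D) = D"
proof -
  let ?h = "D div 2"
  have h: "2 * ?h \<le> D" by simp
  have "card ({1..?h} \<union> {M - ?h..<M}) = 2 * ?h"
    using M_bounds h by (subst card_Un_disjoint) auto
  moreover have "M div 2 \<notin> {1..?h} \<union> {M - ?h..<M}" using M_bounds h by auto
  ultimately show ?thesis
    by (cases "odd D") (auto simp: circulant_steps_def card_insert_if)
qed

lemma link_in: "x \<in> vertices \<Longrightarrow> link x \<in> vertices"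
proof -
  assume x: "x \<in> vertices"
  obtain i w t where xt: "x = (i, w, t)" by (cases x)
  have it: "i < d" "w \<in> W" "t < d * q" using x by (auto simp: xt vertices_def M_def mult.commute)
  have "i * q + t mod q < Suc i * q" using q by simp
  also have "\<dots> \<le> d * q" using it by (intro mult_le_mono1) simp
  finally show ?thesis using it \<sigma> by (simp add: xt vertices_def M_def mult.commute less_mult_imp_div_less)
qed

lemma link_link:
  assumes "x \<in> vertices"
  shows "link (link x) = x"
  using assms q \<sigma>\<sigma> by (cases x) (auto simp: vertices_def)

lemma nbrs_subset: "x \<in> vertices \<Longrightarrow> nbrs x \<subseteq> vertices"
proof -
  assume x: "x \<in> vertices"
  obtain i w t where xt: "x = (i, w, t)" by (cases x)
  show ?thesis using x link_in[OF x] M_bounds(2) unfolding xt by (auto simp: vertices_def simp del: link.simps)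
qed

lemma mod_shift_ne:
  assumes "t < M" "0 < s" "s < M"
  shows "(t + s) mod M \<noteq> t"
proof (cases "t + s < M")
  case False
  then have "(t + s) mod M = t + s - M" using assms by (simp add: mod_if)
  then show ?thesis using assms False by simp
qed (use assms in simp)

lemma link_fst_snd_ne: "x \<in> vertices \<Longrightarrow> fst (snd (link x)) \<noteq> fst (snd x)"
  using \<sigma>_ne by (cases x) (auto simp: vertices_def)

lemma nbrs_irrefl: "x \<in> vertices \<Longrightarrow> x \<notin> nbrs x"
proof -
  assume x: "x \<in> vertices"
  obtain i w t where xt: "x = (i, w, t)" by (cases x)
  have t: "t < M" using x by (simp add: xt vertices_def)
  show ?thesis
    using link_fst_snd_ne[OF x] mod_shift_ne[OF t circulant_steps_range] unfolding xt
    by (auto simp del: link.simps) metis+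
qed

lemma mod_shift_back:
  assumes "t < M" "s \<le> M"
  shows "((t + s) mod M + (M - s)) mod M = t" "((t + (M - s)) mod M + s) mod M = t"
proof -
  have "((t + s) mod M + (M - s)) mod M = (t + s + (M - s)) mod M" by (rule mod_add_left_eq)
  also have "t + s + (M - s) = t + M" using assms by simp
  finally show "((t + s) mod M + (M - s)) mod M = t" using assms by simp
  have "((t + (M - s)) mod M + s) mod M = (t + (M - s) + s) mod M" by (rule mod_add_left_eq)
  also have "t + (M - s) + s = t + M" using assms by simp
  finally show "((t + (M - s)) mod M + s) mod M = t" using assms by simp
qed

lemma nbrs_sym:
  assumes x: "x \<in> vertices" and y: "y \<in> nbrs x"
  shows "x \<in> nbrs y"
proof -
  obtain i w t where xt: "x = (i, w, t)" by (cases x)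
  have it: "i < d" "t < M" using x by (simp_all add: xt vertices_def)
  consider s where "s \<in> circulant_steps M D" "y = (i, w, (t + s) mod M)"
    | j where "j < d" "j \<noteq> i" "y = (j, w, t)"
    | j where "j < d" "j \<noteq> i" "y = (j, w, (if i < j then t + 1 else t + (M - 1)) mod M)"
    | "y = link x"
    using y unfolding xt nbrs.simps by blast
  then show ?thesis
  proof cases
    case 1
    have "s \<le> M" using circulant_steps_range[OF 1(1)] by simp
    from mod_shift_back(1)[OF it(2) this] show ?thesis
      using nbrs_step[OF circulant_steps_minus[OF 1(1)], of i w "(t + s) mod M"] by (simp only: xt 1)
  next
    case 2
    then show ?thesis using nbrs_cross[of i j w t] it by (simp only: xt)
  next
    case 3
    show ?thesis
    proof (cases "i < j")
      case True
      then show ?thesis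
        using nbrs_cross_unshift[OF it(1) True, of w "(t + 1) mod M"] mod_shift_back(1)[OF it(2), of 1] M_bounds 3
        by (simp add: xt del: nbrs.simps)
    next
      case False
      then have "j < i" using 3 by simp
      then show ?thesis
        using nbrs_cross_shift[OF it(1), of j w "(t + (M - 1)) mod M"] mod_shift_back(2)[OF it(2), of 1] M_bounds 3
        by (simp add: xt del: nbrs.simps)
    qed
  next
    case 4
    then show ?thesis using nbrs_link[of y] link_link[OF x] by simp
  qed
qed

text \<open>The four kinds of neighbours do not overlap: circulant steps stay in the class, the two
  cross edges to another class end at different positions, and the link alone changes the point of
  \<open>W\<close>.\<close>

lemma card_nbrs:
  assumes x: "x \<in> vertices"
  shows "card (nbrs x) = D + 2 * (d - 1) + 1"
proof -
  obtain i w t where xt: "x = (i, w, t)" by (cases x)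
  have it: "i < d" "t < M" using x by (simp_all add: xt vertices_def)
  let ?A = "(\<lambda>s. (i, w, (t + s) mod M)) ` circulant_steps M D"
  let ?B = "(\<lambda>j. (j, w, t)) ` ({..<d} - {i})"
  define c where "c j = (if i < j then t + 1 else t + (M - 1)) mod M" for j
  let ?C = "(\<lambda>j. (j, w, c j)) ` ({..<d} - {i})"
  have fin: "finite (circulant_steps M D)" by (simp add: circulant_steps_def)
  have "inj_on (\<lambda>s. (i, w, (t + s) mod M)) (circulant_steps M D)"
  proof (rule inj_onI)
    fix s s' assume ss: "s \<in> circulant_steps M D" "s' \<in> circulant_steps M D"
      and "(i, w, (t + s) mod M) = (i, w, (t + s') mod M)"
    then have eq: "(t + s) mod M = (t + s') mod M" by simp
    have "(t + a) mod M = (if t + a < M then t + a else t + a - M)" if "a < M" for a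
      using that it(2) by (simp add: mod_if)
    then show "s = s'" using eq it(2) circulant_steps_range[OF ss(1)] circulant_steps_range[OF ss(2)]
      by (auto split: if_splits)
  qed
  then have cA: "card ?A = D" using card_circulant_steps by (simp add: card_image)
  have cB: "card ?B = d - 1" using it by (subst card_image) (auto simp: inj_on_def)
  have cC: "card ?C = d - 1" using it by (subst card_image) (auto simp: inj_on_def)
  have tne: "c j \<noteq> t" for j
    using mod_shift_ne[OF it(2), of 1] mod_shift_ne[OF it(2), of "M - 1"] M_bounds by (auto simp: c_def)
  have "card (?A \<union> ?B) = D + (d - 1)" using fin cA cB by (subst card_Un_disjoint) auto
  then have "card (?A \<union> ?B \<union> ?C) = D + (d - 1) + (d - 1)"
    using fin cC tne by (subst card_Un_disjoint) auto
  moreover have "link x \<notin> ?A \<union> ?B \<union> ?C" using link_fst_snd_ne[OF x] by (auto simp: xt)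
  moreover have "nbrs x = insert (link x) (?A \<union> ?B \<union> ?C)" unfolding xt nbrs.simps c_def by blast
  ultimately show ?thesis using fin by simp
qed

end

section \<open>Assembling the bound\<close>

text \<open>These pairs index the functionals: i = j for the mean of coordinate i over class i, i <
  j for the mean of the difference of two coordinates over both classes.\<close>

lemma card_le_pairs: "card {(i, j). i \<le> j \<and> j < d} = (d + 1 choose 2)"
proof (induction d)
  case (Suc d)
  have split: "{(i, j). i \<le> j \<and> j < Suc d} = {(i, j). i \<le> j \<and> j < d} \<union> (\<lambda>i. (i, d)) ` {..d}"
    by (auto simp: less_Suc_eq)
  have fin: "finite {(i, j). i \<le> j \<and> j < d}"
    by (rule finite_subset[of _ "{..<d} \<times> {..<d}"]) auto
  have new: "card ((\<lambda>i. (i, d)) ` {..d}) = d + 1" by (subst card_image) (auto simp: inj_on_def)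
  have "card ({(i, j). i \<le> j \<and> j < d} \<union> (\<lambda>i. (i, d)) ` {..d}) = (d + 1 choose 2) + (d + 1)"
    using fin new Suc by (subst card_Un_disjoint) auto
  then have "card {(i, j). i \<le> j \<and> j < Suc d} = (d + 1 choose 2) + (d + 1)" by (simp only: split)
  then show ?case by (simp add: numeral_2_eq_2)
qed simp

context layered_graph
begin

lemma sum_pair_layer:
  fixes F :: "nat \<times> 'w \<times> nat \<Rightarrow> real"
  shows "(\<Sum>w\<in>W. \<Sum>(l, t)\<in>{i, j} \<times> {..<M}. F (l, w, t)) = (\<Sum>x\<in>{i, j} \<times> W \<times> {..<M}. F x)"
proof -
  have "(\<Sum>w\<in>W. \<Sum>(l, t)\<in>{i, j} \<times> {..<M}. F (l, w, t))
    = (\<Sum>(w, l, t)\<in>W \<times> {i, j} \<times> {..<M}. F (l, w, t))"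
    by (subst sum.cartesian_product) (simp add: case_prod_unfold)
  also have "\<dots> = (\<Sum>x\<in>{i, j} \<times> W \<times> {..<M}. F x)"
    by (rule sum.reindex_bij_witness[where i = "\<lambda>(l, w, t). (w, l, t)" and j = "\<lambda>(w, l, t). (l, w, t)"]) auto
  finally show ?thesis .
qed

text \<open>In class i the pair (i, i) controls coordinate i, and for a \<noteq> i the pair of i and
  a controls the difference from coordinate a. Together they bound each coordinate by 4 B, and there
  are d^2 combinations of class and coordinate.\<close>

lemma energy_controls_norm:
  fixes Y :: "nat \<times> 'w \<times> nat \<Rightarrow> nat \<Rightarrow> real" and B :: real
  assumes B: "\<And>i j. i \<le> j \<Longrightarrow> j < d \<Longrightarrow> (\<Sum>x\<in>{i, j} \<times> W \<times> {..<M}. (pair_coord i j (Y x))\<^sup>2) \<le> B"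
  shows "(\<Sum>x\<in>vertices. \<Sum>a<d. (Y x a)\<^sup>2) \<le> 4 * (real d)\<^sup>2 * B"
proof -
  let ?T = "W \<times> {..<M}"
  have layer: "(\<Sum>z\<in>?T. (pair_coord i j (Y (l, z)))\<^sup>2) \<le> B" if "i \<le> j" "j < d" "l \<in> {i, j}" for i j l
  proof -
    have "(\<Sum>z\<in>?T. (pair_coord i j (Y (l, z)))\<^sup>2) = (\<Sum>x\<in>{l} \<times> ?T. (pair_coord i j (Y x))\<^sup>2)"
      by (rule sum.reindex_bij_witness[where i = snd and j = "\<lambda>z. (l, z)"]) auto
    also have "\<dots> \<le> (\<Sum>x\<in>{i, j} \<times> ?T. (pair_coord i j (Y x))\<^sup>2)"
      using that finW by (intro sum_mono2) auto
    also have "\<dots> \<le> B" using B that by simp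
    finally show ?thesis .
  qed
  have pt: "(Y (i, z) a)\<^sup>2 \<le> 2 * (pair_coord i i (Y (i, z)))\<^sup>2
      + 2 * (pair_coord (min i a) (max i a) (Y (i, z)))\<^sup>2" for i z a
  proof (cases "a = i")
    case False
    have "(pair_coord (min i a) (max i a) (Y (i, z)))\<^sup>2 = (Y (i, z) a - Y (i, z) i)\<^sup>2"
      using False by (auto simp: pair_coord_def min_def max_def power2_commute)
    then show ?thesis using square_diff_via[of "Y (i, z) a" 0 "Y (i, z) i"] by (simp add: pair_coord_def)
  qed (simp add: pair_coord_def)
  have one: "(\<Sum>z\<in>?T. (Y (i, z) a)\<^sup>2) \<le> 4 * B" if "i < d" "a < d" for i a
  proof -
    have "(\<Sum>z\<in>?T. (Y (i, z) a)\<^sup>2) \<le> (\<Sum>z\<in>?T. 2 * (pair_coord i i (Y (i, z)))\<^sup>2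
      + 2 * (pair_coord (min i a) (max i a) (Y (i, z)))\<^sup>2)" by (intro sum_mono pt)
    also have "\<dots> = 2 * (\<Sum>z\<in>?T. (pair_coord i i (Y (i, z)))\<^sup>2)
      + 2 * (\<Sum>z\<in>?T. (pair_coord (min i a) (max i a) (Y (i, z)))\<^sup>2)"
      by (simp add: sum.distrib sum_distrib_left)
    also have "\<dots> \<le> 2 * B + 2 * B"
      using that by (intro add_mono mult_left_mono layer) (auto simp: min_def max_def)
    finally show ?thesis by simp
  qed
  have "(\<Sum>x\<in>vertices. \<Sum>a<d. (Y x a)\<^sup>2) = (\<Sum>i<d. \<Sum>z\<in>?T. \<Sum>a<d. (Y (i, z) a)\<^sup>2)"
    unfolding vertices_def by (subst sum.cartesian_product) simp
  also have "\<dots> = (\<Sum>i<d. \<Sum>a<d. \<Sum>z\<in>?T. (Y (i, z) a)\<^sup>2)" by (rule sum.cong[OF refl], rule sum.swap)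
  also have "\<dots> \<le> (\<Sum>i<d. \<Sum>a<d. 4 * B)" using one by (intro sum_mono) auto
  also have "\<dots> = 4 * (real d)\<^sup>2 * B" by (simp add: power2_eq_square)
  finally show ?thesis .
qed

text \<open>The factor 8 d^2 is the 4 d^2 of \<open>energy_controls_norm\<close> times the 2 of
  \<open>energy_ge\<close>; 32 comes from the placement. Apart from C the bound depends on d and M
  only, not on the size of \<open>W\<close>.\<close>

lemma expander_graph:
  fixes C :: real
  assumes C: "C > 0" and W: "W \<noteq> {}"
    and poin: "\<And>\<psi>::'w \<Rightarrow> real. \<exists>a. (\<Sum>w\<in>W. (\<psi> w - a)\<^sup>2) \<le> C * (\<Sum>l<5. \<Sum>w\<in>W. (\<psi> (\<sigma> l w) - \<psi> w)\<^sup>2)"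
  defines "n \<equiv> card vertices"
  shows "\<exists>E. finite_simple_graph {..<n} E \<and> regular_graph (D + 2 * (d - 1) + 1) {..<n} E \<and>
     algebraic_connectivity d {..<n} E
       \<ge> 1 / (32 * (8 * (real d)\<^sup>2 * (4 * real M * (8 * real M ^ 3 + C * (5 * (48 * real M ^ 3 + 3))))))"
proof -
  define C1 where "C1 = 4 * real M * (8 * real M ^ 3 + C * (5 * (48 * real M ^ 3 + 3)))"
  have "real M > 0" using M_bounds by simp
  then have C1: "C1 > 0" unfolding C1_def using C by (intro mult_pos_pos add_pos_pos) auto
  have finV: "finite vertices" using finW by (simp add: vertices_def)
  obtain \<phi> where bij: "bij_betw \<phi> {..<n} vertices"
    using ex_bij_betw_nat_finite[OF finV] by (auto simp: n_def lessThan_atLeast0)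
  interpret relabelling n \<phi> vertices nbrs
    using bij nbrs_subset nbrs_irrefl nbrs_sym by unfold_locales auto
  define \<psi> where "\<psi> = inv_into {..<n} \<phi>"
  have \<psi>\<phi>: "\<psi> (\<phi> u) = u" if "u < n" for u
    unfolding \<psi>_def using bij that by (auto simp: bij_betw_def)
  have rel: "(\<Sum>u<n. F (\<phi> u)) = (\<Sum>x\<in>vertices. F x)" for F :: "nat \<times> 'w \<times> nat \<Rightarrow> real"
    by (rule sum.reindex_bij_betw[OF bij])
  \<comment> \<open>Summing against X gives the sum of \<open>pair_coord i j\<close> over the
    classes i and j; the guard \<open>i \<noteq> j\<close> keeps the two terms from cancelling when
    i = j.\<close>
  define c where "c = (\<lambda>(i, j) u a. if fst (\<phi> u) \<in> {i, j} then
      (if a = i then 1 else 0) - (if a = j \<and> i \<noteq> j then 1 else 0) else (0::real))"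
  let ?K = "{(i, j). i \<le> j \<and> j < d}"
  have "algebraic_connectivity d {..<n} E \<ge> 1 / (32 * (8 * (real d)\<^sup>2 * C1))"
  proof (rule algebraic_connectivity_ge_partition[where part = "\<lambda>u. fst (\<phi> u)" and K = ?K and c = c])
    show "8 * (real d)\<^sup>2 * C1 > 0" using C1 d by simp
    show "fst (\<phi> u) < d" if "u < n" for u using in_S[OF that] by (auto simp: vertices_def)
    show "finite ?K" by (rule finite_subset[of _ "{..<d} \<times> {..<d}"]) auto
    show "card ?K = (d + 1 choose 2)" by (rule card_le_pairs)
    show "(d + 1 choose 2) < d * n"
    proof -
      have "card W \<ge> 1" using W finW by (simp add: Suc_leI card_gt_0_iff)
      then have "1 * M \<le> card W * M" by (rule mult_le_mono1)
      then have "1 < card W * M" using M_bounds by linarith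
      then have "d * 1 < d * (card W * M)" using d by (intro mult_strict_left_mono) auto
      also have "d * (card W * M) = n" by (simp add: n_def vertices_def card_cartesian_product)
      finally have dn: "d < n" by simp
      have "(d + 1) * d div 2 \<le> d * d" using d by (cases d) auto
      also have "d * d < d * n" using dn d by simp
      finally show ?thesis by (simp add: choose_two mult.commute)
    qed
  next
    fix X :: "nat \<Rightarrow> nat \<Rightarrow> real"
    assume con: "\<forall>k\<in>?K. (\<Sum>u<n. \<Sum>a<d. c k u a * X u a) = 0"
    define Y where "Y x = X (\<psi> x)" for x
    have XY: "X u = Y (\<phi> u)" if "u < n" for u using \<psi>\<phi>[OF that] by (simp add: Y_def)
    define Q where "Q = (\<Sum>(u, v)\<in>{(u, v). u < v \<and> v < n \<and> {u, v} \<in> E}.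
        (pair_coord (fst (\<phi> u)) (fst (\<phi> v)) (X u) - pair_coord (fst (\<phi> u)) (fst (\<phi> v)) (X v))\<^sup>2)"
    have Q: "Q = (\<Sum>(u, v)\<in>{(u, v). u < v \<and> v < n \<and> {u, v} \<in> E}. disc Y (\<phi> u) (\<phi> v))"
      unfolding Q_def disc_def by (intro sum.cong refl) (auto simp: XY)
    have sym: "disc Y x y = disc Y y x" for x y
      by (auto simp: disc_def pair_coord_def power2_eq_square algebra_simps)
    have en: "(\<Sum>w\<in>W. disc Y (x w) (y w)) \<le> 2 * Q"
      if "inj_on x W" "\<And>w. w \<in> W \<Longrightarrow> x w \<in> vertices \<and> y w \<in> nbrs (x w)" for x y
      unfolding Q using that by (intro energy_ge sym finW) (auto simp: disc_def simp del: nbrs.simps)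
    have "(\<Sum>x\<in>vertices. \<Sum>a<d. (Y x a)\<^sup>2) \<le> 4 * (real d)\<^sup>2 * (C1 * (2 * Q))"
    proof (rule energy_controls_norm)
      fix i j assume ij: "i \<le> j" "j < d"
      let ?A = "{i, j} \<times> W \<times> {..<M}"
      have "(\<Sum>x\<in>?A. pair_coord i j (Y x)) = (\<Sum>x\<in>vertices. if fst x \<in> {i, j} then pair_coord i j (Y x) else 0)"
      proof -
        have "?A = vertices \<inter> {x. fst x \<in> {i, j}}" using ij by (auto simp: vertices_def)
        then show ?thesis using finV by (simp add: sum.inter_restrict)
      qed
      also have "\<dots> = (\<Sum>u<n. if fst (\<phi> u) \<in> {i, j} then pair_coord i j (Y (\<phi> u)) else 0)"
        by (rule rel[symmetric])
      also have "\<dots> = (\<Sum>u<n. \<Sum>a<d. c (i, j) u a * X u a)"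
      proof (rule sum.cong[OF refl])
        fix u assume "u \<in> {..<n}"
        then have u: "u < n" by simp
        have "(\<Sum>a<d. ((if a = i then 1 else 0) - (if a = j \<and> i \<noteq> j then 1 else 0)) * X u a)
          = (\<Sum>a<d. (if a = i then X u i else 0) - (if a = j then if i \<noteq> j then X u j else 0 else 0))"
          by (intro sum.cong) auto
        also have "\<dots> = pair_coord i j (X u)" using ij by (simp add: sum_subtractf pair_coord_def)
        finally show "(if fst (\<phi> u) \<in> {i, j} then pair_coord i j (Y (\<phi> u)) else 0) = (\<Sum>a<d. c (i, j) u a * X u a)"
          using XY[OF u] by (simp add: c_def)
      qed
      also have "\<dots> = 0" using con ij by auto
      finally have mean: "(\<Sum>x\<in>?A. pair_coord i j (Y x)) = 0" .
      obtain a where a: "(\<Sum>w\<in>W. \<Sum>(l, t)\<in>{i, j} \<times> {..<M}. (pair_coord i j (Y (l, w, t)) - a)\<^sup>2) \<le> C1 * (2 * Q)"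
        using pair_poincare[where Y = Y and Q = "2 * Q", OF less_imp_le[OF C] poin en ij] unfolding C1_def by blast
      have "(\<Sum>x\<in>?A. (pair_coord i j (Y x))\<^sup>2) \<le> (\<Sum>x\<in>?A. (pair_coord i j (Y x) - a)\<^sup>2)"
        by (rule sum_square_diff_ge[OF mean])
      also have "\<dots> \<le> C1 * (2 * Q)" using a sum_pair_layer[of "\<lambda>x. (pair_coord i j (Y x) - a)\<^sup>2" i j] by simp
      finally show "(\<Sum>x\<in>?A. (pair_coord i j (Y x))\<^sup>2) \<le> C1 * (2 * Q)" .
    qed
    also have "(\<Sum>x\<in>vertices. \<Sum>a<d. (Y x a)\<^sup>2) = (\<Sum>u<n. \<Sum>a<d. (X u a)\<^sup>2)"
      using rel[of "\<lambda>x. \<Sum>a<d. (Y x a)\<^sup>2"] XY by simp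
    finally show "(\<Sum>u<n. \<Sum>a<d. (X u a)\<^sup>2) \<le> 8 * (real d)\<^sup>2 * C1 *
      (\<Sum>(u, v)\<in>{(u, v). u < v \<and> v < n \<and> {u, v} \<in> E}.
        (pair_coord (fst (\<phi> u)) (fst (\<phi> v)) (X u) - pair_coord (fst (\<phi> u)) (fst (\<phi> v)) (X v))\<^sup>2)"
      unfolding Q_def[symmetric] by (simp add: mult_ac)
  qed
  then show ?thesis using simple regular[OF card_nbrs] unfolding C1_def by blast
qed

end

theorem theorem1p2:
  fixes d k :: nat
  assumes "d \<ge> 1" and "k \<ge> 2 * d + 1"
  shows "\<exists>\<epsilon>>0. \<exists>(V :: nat \<Rightarrow> nat set) (E :: nat \<Rightarrow> nat set set).
           (\<forall>i. finite_simple_graph (V i) (E i) \<and> regular_graph k (V i) (E i)) \<and>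
           strict_mono (\<lambda>i. card (V i)) \<and>
           (\<forall>i. algebraic_connectivity d (V i) (E i) \<ge> \<epsilon>)"
proof -
  \<comment> \<open>The degree left after 2 (d - 1) cross edges and one link; k \<ge> 2 d + 1 is
    what makes it at least 2.\<close>
  define D where "D = k - 2 * d + 1"
  define q where "q = 2 * (D + 5)"
  define M where "M = q * d"
  have D: "D \<ge> 2" and k: "D + 2 * (d - 1) + 1 = k" using assms by (auto simp: D_def)
  obtain C :: real where C: "C > 0" and base: "\<And>r::nat. r > 0 \<Longrightarrow>
     (\<exists>(W :: ((int \<times> int) \<times> bool) set) \<sigma>.
        finite W \<and> card W = 128 * r\<^sup>2 \<and>
        (\<forall>l. \<forall>w\<in>W. \<sigma> l w \<in> W \<and> \<sigma> l (\<sigma> l w) = w \<and> \<sigma> l w \<noteq> w) \<and>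
        (\<forall>\<psi>::(int \<times> int) \<times> bool \<Rightarrow> real.
           \<exists>a. (\<Sum>w\<in>W. (\<psi> w - a)\<^sup>2) \<le> C * (\<Sum>l<5::nat. \<Sum>w\<in>W. (\<psi> (\<sigma> l w) - \<psi> w)\<^sup>2)))"
    using expander_involutions by blast
  \<comment> \<open>\<open>M\<close> and \<open>C\<close> do not involve the index of the family, so
    this value serves all graphs.\<close>
  define \<epsilon> where "\<epsilon> = 1 / (32 * (8 * (real d)\<^sup>2 * (4 * real M * (8 * real M ^ 3 + C * (5 * (48 * real M ^ 3 + 3))))))"
  have M0: "real M > 0" using assms by (simp add: M_def q_def)
  have \<epsilon>: "\<epsilon> > 0" unfolding \<epsilon>_def
    using M0 C assms by (intro divide_pos_pos mult_pos_pos add_pos_pos) auto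
  define N where "N i = d * (128 * (i + 1)\<^sup>2 * M)" for i
  have "\<exists>E. finite_simple_graph {..<N i} E \<and> regular_graph k {..<N i} E \<and>
      algebraic_connectivity d {..<N i} E \<ge> \<epsilon>" for i
  proof -
    obtain W :: "((int \<times> int) \<times> bool) set" and \<sigma> where W: "finite W" "card W = 128 * (i + 1)\<^sup>2"
      and \<sigma>: "\<And>l w. w \<in> W \<Longrightarrow> \<sigma> l w \<in> W \<and> \<sigma> l (\<sigma> l w) = w \<and> \<sigma> l w \<noteq> w"
      and poin: "\<And>\<psi>::(int \<times> int) \<times> bool \<Rightarrow> real.
           \<exists>a. (\<Sum>w\<in>W. (\<psi> w - a)\<^sup>2) \<le> C * (\<Sum>l<5::nat. \<Sum>w\<in>W. (\<psi> (\<sigma> l w) - \<psi> w)\<^sup>2)"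
      using base[OF zero_less_Suc[of i], unfolded Suc_eq_plus1] by blast
    interpret G: layered_graph d q D W \<sigma>
      using assms D W \<sigma> by unfold_locales (auto simp: q_def)
    have GM: "G.M = M" by (simp add: G.M_def M_def)
    have card: "card G.vertices = N i"
      by (simp add: G.vertices_def card_cartesian_product N_def GM W(2) mult_ac)
    have ne: "W \<noteq> {}" using W(2) by auto
    show ?thesis
      using G.expander_graph[OF C ne poin] unfolding GM k card \<epsilon>_def .
  qed
  then have "\<forall>i. \<exists>E. finite_simple_graph {..<N i} E \<and> regular_graph k {..<N i} E \<and>
      algebraic_connectivity d {..<N i} E \<ge> \<epsilon>" by blast
  from choice[OF this] obtain E where E: "\<And>i. finite_simple_graph {..<N i} (E i) \<and> regular_graph k {..<N i} (E i) \<and>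
      algebraic_connectivity d {..<N i} (E i) \<ge> \<epsilon>" by blast
  have "strict_mono N"
  proof (rule strict_monoI)
    fix i j :: nat assume "i < j"
    then have "(i + 1)\<^sup>2 < (j + 1)\<^sup>2" by (intro power_strict_mono) auto
    then show "N i < N j" using M0 assms by (simp add: N_def)
  qed
  then show ?thesis using \<epsilon> E by (intro exI[of _ \<epsilon>] conjI exI[of _ "\<lambda>i. {..<N i}"] exI[of _ E]) auto
qed

end
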